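(* Let $\Omega\subset\mathbb{C}^r_t\times\mathbb{C}^n_z$ be a pseudoconvex domain, and let $p:\Omega\to U:=p(\Omega)\subset\mathbb{C}^r$, $p(t,z)=t$, be the natural projection, such that for every $t\in U$ the fiber $\Omega_t:=p^{-1}(t)$ is a (connected) Reinhardt domain. Let $\varphi$ be a plurisubharmonic function on $\Omega$ such that $\varphi(t,\alpha z)=\varphi(t,z)$ for all $(t,z)\in\Omega$ and all $\alpha\in T^n$. Then the function $\varphi^*$ defined by $$\varphi^*(t):=\inf_{z\in\Omega_t}\varphi(t,z)$$ is a plurisubharmonic function on $U$.
   Context: Coordinates on $\mathbb{C}^r\times\mathbb{C}^n$ are denoted $(t,z)$. The fiber $\Omega_t=p^{-1}(t)$ is identified with the open set $\{z\in\mathbb{C}^n : (t,z)\in\Omega\}$. $T^n$ is the $n$-dimensional torus group, acting on $\mathbb{C}^n$ by $(e^{i\theta_1},\dots,e^{i\theta_n})\cdot(z_1,\dots,z_n):=(e^{i\theta_1}z_1,\dots,e^{i\theta_n}z_n)$; for $\alpha\in T^n$, $\alpha z$ denotes this action. A domain $D\subset\mathbb{C}^n$ is called a Reinhardt domain if it is invariant under the action of $T^n$ (it is not required to contain the origin). Plurisubharmonic functions take values in $[-\infty,\infty)$, and the function identically $-\infty$ is regarded as plurisubharmonic. *)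

theory Defs
  imports "HOL-Analysis.Analysis"
begin

class complex_vector = real_vector +
  fixes scaleC :: "complex \<Rightarrow> 'a \<Rightarrow> 'a" (infixr "*\<^sub>C" 75)
  assumes scaleC_of_real: "complex_of_real r *\<^sub>C x = r *\<^sub>R x"
    and scaleC_add_right: "a *\<^sub>C (x + y) = a *\<^sub>C x + a *\<^sub>C y"
    and scaleC_add_left: "(a + b) *\<^sub>C x = a *\<^sub>C x + b *\<^sub>C x"
    and scaleC_scaleC: "a *\<^sub>C b *\<^sub>C x = (a * b) *\<^sub>C x"

instantiation complex :: complex_vector
begin
definition scaleC_complex :: "complex \<Rightarrow> complex \<Rightarrow> complex" where
  "scaleC_complex a x = a * x"
instance
  by standard (auto simp: scaleC_complex_def scaleR_conv_of_real algebra_simps)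
end

instantiation vec :: (complex_vector, finite) complex_vector
begin
definition scaleC_vec :: "complex \<Rightarrow> ('a, 'b) vec \<Rightarrow> ('a, 'b) vec" where
  "scaleC_vec a x = (\<chi> i. a *\<^sub>C (x $ i))"
instance
  by standard
    (auto simp: scaleC_vec_def vec_eq_iff scaleC_of_real scaleC_add_right scaleC_add_left
      scaleC_scaleC)
end

instantiation prod :: (complex_vector, complex_vector) complex_vector
begin
definition scaleC_prod :: "complex \<Rightarrow> 'a \<times> 'b \<Rightarrow> 'a \<times> 'b" where
  "scaleC_prod a x = (a *\<^sub>C fst x, a *\<^sub>C snd x)"
instance
  by standard
    (auto simp: scaleC_prod_def prod_eq_iff scaleC_of_real scaleC_add_right scaleC_add_left
      scaleC_scaleC)
end

definition upper_semicontinuous_on ::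
  "'a::topological_space set \<Rightarrow> ('a \<Rightarrow> ereal) \<Rightarrow> bool" where
  "upper_semicontinuous_on S f \<longleftrightarrow>
     (\<forall>c. openin (top_of_set S) {x \<in> S. f x < c})"

text \<open>
  The Lebesgue integral of an extended-real function, as the integral of the positive part minus
  that of the negative part (note that \<^const>\<open>e2ennreal\<close> sends negative arguments to 0).
  It is only used for functions that are upper semicontinuous and \<open>< \<infinity>\<close> on a circle, for which
  the integral of the positive part is finite, so the difference is never \<open>\<infinity> - \<infinity>\<close>.
\<close>
definition ereal_integral :: "'a measure \<Rightarrow> ('a \<Rightarrow> ereal) \<Rightarrow> ereal" where
  "ereal_integral M f =
     enn2ereal (\<integral>\<^sup>+ x. e2ennreal (f x) \<partial>M) - enn2ereal (\<integral>\<^sup>+ x. e2ennreal (- f x) \<partial>M)"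

definition circle_mean :: "(complex \<Rightarrow> ereal) \<Rightarrow> complex \<Rightarrow> real \<Rightarrow> ereal" where
  "circle_mean u c R =
     ereal (1 / (2 * pi)) *
     ereal_integral (restrict_space lborel {0..2 * pi}) (\<lambda>\<theta>. u (c + of_real R * cis \<theta>))"

text \<open>The function identically \<open>-\<infinity>\<close> counts as (pluri)subharmonic.\<close>

definition subharmonic_on :: "complex set \<Rightarrow> (complex \<Rightarrow> ereal) \<Rightarrow> bool" where
  "subharmonic_on V u \<longleftrightarrow>
     open V \<and> (\<forall>z\<in>V. u z < \<infinity>) \<and> upper_semicontinuous_on V u \<and>
     (\<forall>c R. 0 < R \<and> cball c R \<subseteq> V \<longrightarrow> u c \<le> circle_mean u c R)"

definition plurisubharmonic_on ::
  "'a::{complex_vector, topological_space} set \<Rightarrow> ('a \<Rightarrow> ereal) \<Rightarrow> bool" where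
  "plurisubharmonic_on S f \<longleftrightarrow>
     open S \<and> (\<forall>x\<in>S. f x < \<infinity>) \<and> upper_semicontinuous_on S f \<and>
     (\<forall>a b. subharmonic_on {\<zeta>. a + \<zeta> *\<^sub>C b \<in> S} (\<lambda>\<zeta>. f (a + \<zeta> *\<^sub>C b)))"

definition is_domain :: "'a::topological_space set \<Rightarrow> bool" where
  "is_domain S \<longleftrightarrow> open S \<and> connected S \<and> S \<noteq> {}"

text \<open>Existence of a continuous plurisubharmonic exhaustion function.\<close>

definition pseudoconvex :: "'a::{complex_vector, topological_space} set \<Rightarrow> bool" where
  "pseudoconvex S \<longleftrightarrow>
     open S \<and>
     (\<exists>u :: 'a \<Rightarrow> real.
        continuous_on S u \<and> plurisubharmonic_on S (\<lambda>x. ereal (u x)) \<and>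
        (\<forall>c. compact (closure {x \<in> S. u x < c}) \<and> closure {x \<in> S. u x < c} \<subseteq> S))"

definition torus :: "(complex ^ 'n::finite) set" where
  "torus = range (\<lambda>\<theta> :: real ^ 'n. \<chi> i. cis (\<theta> $ i))"

definition torus_act :: "complex ^ 'n::finite \<Rightarrow> complex ^ 'n \<Rightarrow> complex ^ 'n" where
  "torus_act \<alpha> z = (\<chi> i. \<alpha> $ i * z $ i)"

definition reinhardt_domain :: "(complex ^ 'n::finite) set \<Rightarrow> bool" where
  "reinhardt_domain D \<longleftrightarrow>
     is_domain D \<and> (\<forall>\<alpha>\<in>torus. torus_act \<alpha> ` D = D)"

definition fiber :: "('a \<times> 'b) set \<Rightarrow> 'a \<Rightarrow> 'b set" where
  "fiber \<Omega> t = {z. (t, z) \<in> \<Omega>}"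

end

theory Submission
  imports Defs "HOL-Complex_Analysis.Cauchy_Integral_Formula"
begin

text \<open>
  Write \<open>t = a + \<zeta> b\<close>, so that everything lives over discs in the \<open>\<zeta>\<close>-plane, and use logarithmic
  coordinates \<open>z = exp w\<close> in the fibers. By torus invariance, whether \<open>(t, exp w)\<close> lies in \<open>\<Omega>\<close>, and
  the value of \<open>\<phi>\<close> there, depend only on \<open>x = Re w\<close>, which ranges over an open set \<open>log_fiber \<Omega> t\<close>
  of \<open>\<real>\<^sup>n\<close>. Points with a vanishing coordinate may be left out of the infimum, because \<open>\<phi>\<close> is upper
  semicontinuous and the other points are dense (\<open>log_point_below\<close>).

  The reason for the theorem is that the imaginary part of \<open>w\<close> is free. Suppose that the infimum is
  below \<open>Re p\<close>, for a polynomial \<open>p\<close>, on the boundary circle of a disc. Choose points \<open>X(\<zeta>)\<close> of the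
  logarithmic fibers over the circle, continuously in \<open>\<zeta>\<close>, at which \<open>\<phi>\<close> is below \<open>Re p\<close>. On a circle,
  every continuous real function is a uniform limit of real parts of polynomials
  (\<open>circle_approx_Re_poly\<close>), so \<open>X\<close> may be taken to be \<open>Re w\<close> for a polynomial map \<open>w\<close>. If the
  holomorphic disc \<open>\<zeta> \<mapsto> (t, exp (w \<zeta>))\<close> lies in \<open>\<Omega>\<close>, the maximum principle along it bounds \<open>\<phi>\<close>, and
  with it the infimum, by \<open>Re p\<close> at the center (\<open>minimum_principle_small_disc\<close>). This needs
  the following facts.

  \<^item> A plurisubharmonic function satisfies the maximum principle along nonlinear holomorphic discs
  (\<open>disc_maximum_principle\<close>). The definition speaks of affine discs only; the passage to curved ones
  is made by doubling the variables, so that \<open>\<phi>\<close> need not be regularized.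

  \<^item> The disc stays in \<open>\<Omega>\<close>. This is the continuity principle (\<open>disc_family_stays_inside\<close>): the disc is
  deformed along line segments into one with constant \<open>w\<close>, and during the deformation the boundary
  circle must not leave \<open>\<Omega>\<close>. It does not, because the logarithmic fibers are convex
  (\<open>convex_log_fiber\<close>, which is Bochner's tube theorem in the presence of an exhaustion function).

  \<^item> The continuous choice of \<open>X\<close> is possible because the sublevel sets of \<open>\<phi>\<close> in the logarithmic
  fibers are convex too (\<open>convex_log_sublevel\<close>). Both convexity statements come from a three-lines
  argument (\<open>psh_le_on_log_segment\<close>).

  A constant \<open>w\<close> is available only over small discs. The statement for all discs is obtained from the
  one for small discs by looking at a maximum point (\<open>marginal_le_Re_poly\<close>), and comparison with real
  parts of polynomials is equivalent to the submean inequality (\<open>subharmonic_le_Re_poly\<close>,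
  \<open>le_circle_mean\<close>).
\<close>

section \<open>Upper semicontinuity\<close>

lemma usc_iff_eventually:
  "upper_semicontinuous_on S f \<longleftrightarrow>
     (\<forall>x\<in>S. \<forall>c. f x < c \<longrightarrow> (\<forall>\<^sub>F y in at x within S. f y < c))"
proof
  assume usc: "upper_semicontinuous_on S f"
  show "\<forall>x\<in>S. \<forall>c. f x < c \<longrightarrow> (\<forall>\<^sub>F y in at x within S. f y < c)"
  proof (intro ballI allI impI)
    fix x c assume x: "x \<in> S" "f x < c"
    from usc obtain T where T: "open T" "{x \<in> S. f x < c} = S \<inter> T"
      unfolding upper_semicontinuous_on_def openin_open by blast
    then have "x \<in> T" using x by blast
    then show "\<forall>\<^sub>F y in at x within S. f y < c"
      unfolding eventually_at_topological using T by blast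
  qed
next
  assume ev: "\<forall>x\<in>S. \<forall>c. f x < c \<longrightarrow> (\<forall>\<^sub>F y in at x within S. f y < c)"
  show "upper_semicontinuous_on S f"
    unfolding upper_semicontinuous_on_def
  proof
    fix c
    have "\<exists>T. open T \<and> x \<in> T \<and> S \<inter> T \<subseteq> {x \<in> S. f x < c}" if "x \<in> {x \<in> S. f x < c}" for x
    proof -
      from that ev obtain T where "open T" "x \<in> T" "\<forall>y\<in>T. y \<noteq> x \<longrightarrow> y \<in> S \<longrightarrow> f y < c"
        unfolding eventually_at_topological by blast
      moreover have "S \<inter> T \<subseteq> {x \<in> S. f x < c}" using that calculation by auto
      ultimately show ?thesis by blast
    qed
    then show "openin (top_of_set S) {x \<in> S. f x < c}"
      by (subst openin_subopen) (metis (no_types, lifting) IntI mem_Collect_eq openin_open_Int)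
  qed
qed

lemma usc_add_continuous:
  assumes "upper_semicontinuous_on S f" "continuous_on S h"
  shows "upper_semicontinuous_on S (\<lambda>x. f x + ereal (h x))"
  unfolding usc_iff_eventually
proof (intro ballI allI impI)
  fix x c assume x: "x \<in> S" and lt: "f x + ereal (h x) < c"
  then have "f x < c - ereal (h x)" by (simp add: ereal_less_minus)
  then obtain d where d: "f x < ereal d" "ereal d < c - ereal (h x)"
    using ereal_dense2 by blast
  then have "ereal (h x) < c - ereal d" by (cases c) auto
  then obtain e where e: "ereal (h x) < ereal e" "ereal e < c - ereal d"
    using ereal_dense2 by blast
  have 1: "\<forall>\<^sub>F y in at x within S. f y < ereal d"
    using assms(1) d x unfolding usc_iff_eventually by blast
  have "(h \<longlongrightarrow> h x) (at x within S)" using assms(2) x by (simp add: continuous_on)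
  then have 2: "\<forall>\<^sub>F y in at x within S. h y < e" using e(1) by (intro order_tendstoD) auto
  show "\<forall>\<^sub>F y in at x within S. f y + ereal (h y) < c"
    using 1 2
  proof eventually_elim
    case (elim y)
    then have "f y + ereal (h y) \<le> ereal d + ereal e" by (intro add_mono) auto
    also have "\<dots> < c" using e(2) by (cases c) auto
    finally show ?case .
  qed
qed

lemma usc_compose:
  assumes "upper_semicontinuous_on T f" "continuous_on S g" "g ` S \<subseteq> T"
  shows "upper_semicontinuous_on S (\<lambda>x. f (g x))"
  unfolding upper_semicontinuous_on_def
proof
  fix c
  from assms(1) obtain W where W: "open W" "{x \<in> T. f x < c} = T \<inter> W"
    unfolding upper_semicontinuous_on_def openin_open by blast
  have "f (g x) < c \<longleftrightarrow> g x \<in> W" if "x \<in> S" for x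
  proof -
    have "g x \<in> T" using that assms(3) by auto
    then show ?thesis using W(2) by (auto simp: set_eq_iff)
  qed
  then have "{x \<in> S. f (g x) < c} = S \<inter> g -` W" by auto
  then show "openin (top_of_set S) {x \<in> S. f (g x) < c}"
    using continuous_openin_preimage_gen[OF assms(2) W(1)] by simp
qed

lemma usc_subset:
  "upper_semicontinuous_on T f \<Longrightarrow> S \<subseteq> T \<Longrightarrow> upper_semicontinuous_on S f"
  using usc_compose[of T f S id] by simp

lemma usc_attains_sup:
  assumes "compact S" "S \<noteq> {}" "upper_semicontinuous_on S f"
  obtains x where "x \<in> S" "\<And>y. y \<in> S \<Longrightarrow> f y \<le> f x"
proof -
  have "\<exists>x\<in>S. \<forall>y\<in>S. f y \<le> f x"
  proof (rule ccontr)
    assume "\<not> ?thesis"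
    then have *: "\<And>x. x \<in> S \<Longrightarrow> \<exists>y\<in>S. f x < f y" by (auto simp: not_le)
    have "\<exists>T. open T \<and> {x \<in> S. f x < c} = S \<inter> T" for c
      using assms(3) unfolding upper_semicontinuous_on_def openin_open by blast
    then obtain T where T: "\<And>c. open (T c)" "\<And>c. {x \<in> S. f x < c} = S \<inter> T c" by metis
    have T': "x \<in> T c \<longleftrightarrow> f x < c" if "x \<in> S" for x c
      using T(2)[of c] that by (auto simp: set_eq_iff)
    have "S \<subseteq> (\<Union>y\<in>S. T (f y))" using * T' by fastforce
    then obtain D where D: "D \<subseteq> S" "finite D" "S \<subseteq> (\<Union>y\<in>D. T (f y))"
      using compactE_image[OF assms(1), of S "\<lambda>y. T (f y)"] T(1) by metis
    have "D \<noteq> {}" using D assms(2) by auto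
    with D(2) obtain y where y: "y \<in> D" "f y = Max (f ` D)" using obtains_MAX by metis
    with D obtain y' where "y' \<in> D" "f y < f y'" using T' by (metis UN_E subsetD)
    then show False using y D(2) by (simp add: leD)
  qed
  then show ?thesis using that by blast
qed

lemma usc_closed_superlevel:
  assumes "compact S" "upper_semicontinuous_on S f"
  shows "compact {x \<in> S. c \<le> f x}"
proof -
  have "openin (top_of_set S) {x \<in> S. f x < c}"
    using assms(2) unfolding upper_semicontinuous_on_def by blast
  then have "closedin (top_of_set S) (S - {x \<in> S. f x < c})"
    by (metis closedin_diff closedin_topspace topspace_euclidean_subtopology)
  moreover have "S - {x \<in> S. f x < c} = {x \<in> S. c \<le> f x}" by auto
  ultimately show ?thesis using assms(1) closedin_compact by metis
qed

lemma usc_bounded_above: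
  assumes "compact S" "upper_semicontinuous_on S f" "\<And>x. x \<in> S \<Longrightarrow> f x < \<infinity>"
  obtains B :: real where "0 \<le> B" "\<And>x. x \<in> S \<Longrightarrow> f x \<le> ereal B"
proof (cases "S = {}")
  case False
  with assms obtain x where x: "x \<in> S" "\<And>y. y \<in> S \<Longrightarrow> f y \<le> f x" using usc_attains_sup by metis
  from assms(3)[OF x(1)] obtain b where b: "f x \<le> ereal b" 
    by (cases "f x") auto
  show ?thesis
    by (rule that[of "max 0 b"]) (use x b in \<open>auto intro!: order_trans[OF _ b] simp: le_max_iff_disj ereal_max\<close>)
qed (use that[of 0] in auto)

section \<open>Circle means\<close>

abbreviation circle_measure :: "real measure" where
  "circle_measure \<equiv> restrict_space lborel {0..2 * pi}"

lemma space_circle_measure [simp]: "space circle_measure = {0..2 * pi}"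
  by (simp add: space_restrict_space)

lemma emeasure_circle_measure: "emeasure circle_measure {0..2 * pi} = ennreal (2 * pi)"
  by (simp add: emeasure_restrict_space)

lemma circle_measurable_continuous:
  "continuous_on {0..2 * pi} h \<Longrightarrow> h \<in> borel_measurable circle_measure"
  using borel_measurable_continuous_on_restrict[of "{0..2*pi}" h]
  by (simp cong: measurable_cong_sets add: sets_restrict_space)

lemma circle_integrable_continuous:
  fixes h :: "real \<Rightarrow> real"
  assumes "continuous_on {0..2 * pi} h"
  shows "integrable circle_measure h"
  using borel_integrable_atLeastAtMost'[OF assms]
  by (simp add: set_integrable_def integrable_restrict_space)

lemma circle_lebesgue_integral:
  fixes h :: "real \<Rightarrow> real"
  assumes "continuous_on {0..2 * pi} h" "(h has_integral I) {0..2*pi}"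
  shows "integral\<^sup>L circle_measure h = I"
proof -
  have "set_integrable lborel {0..2*pi} h" using borel_integrable_atLeastAtMost'[OF assms(1)] .
  from set_borel_integral_eq_integral(2)[OF this] show ?thesis using assms(2)
    by (simp add: set_lebesgue_integral_def integral_restrict_space integral_unique)
qed

lemma ereal_integral_mono:
  assumes "\<And>x. x \<in> space M \<Longrightarrow> f x \<le> g x"
  shows "ereal_integral M f \<le> ereal_integral M g"
  unfolding ereal_integral_def
  by (intro ereal_minus_mono)
     (auto simp: assms less_eq_ennreal.rep_eq[symmetric] intro!: nn_integral_mono e2ennreal_mono)

lemma ereal_integral_real:
  assumes "integrable M h"
  shows "ereal_integral M (\<lambda>x. ereal (h x)) = ereal (integral\<^sup>L M h)"
proof -
  have e: "e2ennreal (ereal r) = ennreal r" for r by (simp add: ennreal.abs_eq)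
  from assms have "(\<integral>\<^sup>+ x. ennreal (h x) \<partial>M) \<noteq> \<infinity>" "(\<integral>\<^sup>+ x. ennreal (- h x) \<partial>M) \<noteq> \<infinity>"
    unfolding real_integrable_def by auto
  then show ?thesis
    unfolding ereal_integral_def real_lebesgue_integral_def[OF assms] e uminus_ereal.simps
    by (cases "\<integral>\<^sup>+ x. ennreal (h x) \<partial>M"; cases "\<integral>\<^sup>+ x. ennreal (- h x) \<partial>M") auto
qed

lemma has_integral_cis_power:
  assumes "0 < (k::nat)"
  shows "((\<lambda>\<theta>. cis \<theta> ^ k) has_integral 0) {0..2 * pi}"
proof -
  have d: "((\<lambda>\<theta>. cis (real k * \<theta>) / (\<i> * of_nat k)) has_vector_derivative cis \<theta> ^ k)
      (at \<theta> within {0..2*pi})" for \<theta>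
    using assms unfolding cis_conv_exp
    by (auto intro!: derivative_eq_intros has_vector_derivative_real_field
        simp: exp_of_nat_mult[symmetric] field_simps)
  have "((\<lambda>\<theta>. cis \<theta> ^ k) has_integral
      (cis (real k * (2*pi)) / (\<i> * of_nat k) - cis (real k * 0) / (\<i> * of_nat k))) {0..2 * pi}"
    by (rule fundamental_theorem_of_calculus) (use d in auto)
  moreover have "cis (real k * (2*pi)) = 1"
    using cis_multiple_2pi[of "of_nat k"] by (simp add: mult_ac)
  ultimately show ?thesis by simp
qed

lemma circle_integral_Re_poly:
  "integral\<^sup>L circle_measure (\<lambda>\<theta>. Re (poly p (of_real R * cis \<theta>))) = 2 * pi * Re (poly p 0)"
proof -
  have "((\<lambda>\<theta>. poly p (of_real R * cis \<theta>)) has_integral of_real (2 * pi) * poly p 0) {0..2*pi}"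
  proof (induction p)
    case 0
    then show ?case by simp
  next
    case (pCons a p)
    have 1: "((\<lambda>\<theta>. a) has_integral (of_real (2*pi) * a)) {0..2*pi}"
      using has_integral_const_real[of a 0 "2*pi"] by (simp add: scaleR_conv_of_real)
    have 2: "((\<lambda>\<theta>. of_real R * cis \<theta> * poly p (of_real R * cis \<theta>)) has_integral 0) {0..2*pi}"
    proof -
      have eq: "of_real R * cis \<theta> * poly p (of_real R * cis \<theta>)
          = (\<Sum>i\<le>degree p. (coeff p i * of_real R ^ Suc i) * cis \<theta> ^ Suc i)" for \<theta>
        unfolding poly_altdef
        by (simp add: sum_distrib_left power_mult_distrib mult_ac)
      have "((\<lambda>\<theta>. \<Sum>i\<le>degree p. (coeff p i * of_real R ^ Suc i) * cis \<theta> ^ Suc i)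
          has_integral (\<Sum>i\<le>degree p. (coeff p i * of_real R ^ Suc i) * 0)) {0..2*pi}"
        by (intro has_integral_sum has_integral_mult_right has_integral_cis_power) auto
      then show ?thesis unfolding eq by simp
    qed
    show ?case using has_integral_add[OF 1 2] by simp
  qed
  from has_integral_Re[OF this] show ?thesis
    by (intro circle_lebesgue_integral) (auto intro!: continuous_intros)
qed

lemma circle_mean_Re_poly:
  "circle_mean (\<lambda>\<zeta>. ereal (Re (poly p (\<zeta> - c)))) c R = ereal (Re (poly p 0))"
  unfolding circle_mean_def
  by (subst ereal_integral_real)
     (auto simp: circle_integral_Re_poly intro!: circle_integrable_continuous continuous_intros)

lemma circle_mean_mono:
  assumes "\<And>z. z \<in> sphere c \<bar>R\<bar> \<Longrightarrow> u z \<le> v z"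
  shows "circle_mean u c R \<le> circle_mean v c R"
  unfolding circle_mean_def
  by (intro ereal_mult_left_mono ereal_integral_mono assms)
     (auto simp: dist_norm norm_mult norm_minus_commute)

text \<open>
  Real parts of polynomials have the mean value property, so they may replace circle means as majorants.
  In this form the submean inequality can be used without integrals; \<open>le_circle_mean\<close> below is
  the converse.
\<close>

lemma subharmonic_le_Re_poly:
  assumes "subharmonic_on V u" "0 < R" "cball c R \<subseteq> V"
    and "\<And>z. z \<in> sphere c R \<Longrightarrow> u z \<le> ereal (Re (poly p (z - c)))"
  shows "u c \<le> ereal (Re (poly p 0))"
proof -
  have "u c \<le> circle_mean u c R" using assms(1-3) unfolding subharmonic_on_def by blast
  also have "\<dots> \<le> circle_mean (\<lambda>\<zeta>. ereal (Re (poly p (\<zeta> - c)))) c R"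
    using assms(2,4) by (intro circle_mean_mono) auto
  finally show ?thesis by (simp add: circle_mean_Re_poly)
qed

section \<open>Polynomial majorants on circles\<close>

text \<open>
  On the circle of radius \<open>R\<close> the conjugate of \<open>w\<close> is \<open>R\<^sup>2 / w\<close>, so the product is a Laurent polynomial
  there. Its terms of negative degree may be replaced by their conjugates, which have the same real part
  and are constant multiples of positive powers of \<open>w\<close>. This makes the real parts of polynomials an
  algebra on the circle.
\<close>

lemma Re_poly_mult_cnj_on_circle:
  obtains r where "\<And>w. cmod w = R \<Longrightarrow> Re (poly p w * cnj (poly q w)) = Re (poly r w)"
proof -
  have "\<exists>r. \<forall>w. cmod w = R \<longrightarrow> Re (poly p w * cnj (poly q w)) = Re (poly r w)"
  proof (induction p arbitrary: q)
    case 0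
    show ?case by (rule exI[of _ 0]) simp
  next
    case (pCons a p)
    obtain b q' where q: "q = pCons b q'" by (cases q)
    obtain r where r: "\<And>w. cmod w = R \<Longrightarrow> Re (poly p w * cnj (poly q' w)) = Re (poly r w)"
      using pCons.IH[of q'] by blast
    have "Re (poly (pCons a p) w * cnj (poly q w))
        = Re (poly (smult (cnj a) q + smult (cnj b) (pCons 0 p) + smult (of_real (R\<^sup>2)) r) w)"
      if "cmod w = R" for w
    proof -
      have R: "of_real (R\<^sup>2) = w * cnj w" using that by (simp add: complex_norm_square[symmetric])
      have "poly (pCons a p) w * cnj (poly q w)
          = a * cnj (poly q w) + cnj b * (w * poly p w) + (w * cnj w) * (poly p w * cnj (poly q' w))"
        by (simp add: q algebra_simps)
      also have "Re \<dots> = Re (a * cnj (poly q w)) + Re (cnj b * (w * poly p w))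
          + R\<^sup>2 * Re (poly p w * cnj (poly q' w))"
        unfolding R[symmetric] by simp
      also have "Re (a * cnj (poly q w)) = Re (cnj a * poly q w)" by simp
      finally show ?thesis unfolding r[OF that] by (simp add: algebra_simps)
    qed
    then show ?case by blast
  qed
  then show ?thesis using that by blast
qed

text \<open>
  By Stone-Weierstrass: \<open>Re u * Re v = Re (u * v + u * cnj v) / 2\<close> gives closure under products, and
  \<open>Re w\<close> and \<open>Im w = Re (- \<i> w)\<close> separate points.
\<close>

lemma circle_approx_Re_poly:
  fixes f :: "complex \<Rightarrow> real"
  assumes "continuous_on (sphere c R) f" "0 < e"
  shows "\<exists>p. \<forall>z\<in>sphere c R. \<bar>f z - Re (poly p (z - c))\<bar> < e"
proof -
  define A where "A g \<longleftrightarrow> (\<exists>p. \<forall>z\<in>sphere c R. g z = Re (poly p (z - c)))" for g :: "complex \<Rightarrow> real"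
  have A: "g \<in> Collect A" if "\<And>z. z \<in> sphere c R \<Longrightarrow> g z = Re (poly p (z - c))" for g p
    using that by (auto simp: A_def)
  interpret function_ring_on "Collect A" "sphere c R"
  proof
    show "compact (sphere c R)" by simp
  next
    fix g assume "g \<in> Collect A"
    then obtain p where p: "\<And>z. z \<in> sphere c R \<Longrightarrow> g z = Re (poly p (z - c))" by (auto simp: A_def)
    have "continuous_on (sphere c R) (\<lambda>z. Re (poly p (z - c)))" by (intro continuous_intros)
    then show "continuous_on (sphere c R) g" using p
      by (metis (no_types, lifting) continuous_on_cong)
  next
    fix g h assume "g \<in> Collect A"
      "h \<in> Collect A"
    then obtain p q where p: "\<And>z. z \<in> sphere c R \<Longrightarrow> g z = Re (poly p (z - c))"
      and q: "\<And>z. z \<in> sphere c R \<Longrightarrow> h z = Re (poly q (z - c))" by (auto simp: A_def)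
    have "g z + h z = Re (poly (p + q) (z - c))" if "z \<in> sphere c R" for z
      using p q that by simp
    then show "(\<lambda>z. g z + h z) \<in> Collect A" by (rule A)
    obtain r where r: "\<And>w. cmod w = R \<Longrightarrow> Re (poly p w * cnj (poly q w)) = Re (poly r w)"
      using Re_poly_mult_cnj_on_circle by blast
    have "g z * h z = Re (poly (smult (1/2) (p * q + r)) (z - c))" if z: "z \<in> sphere c R" for z
    proof -
      have "cmod (z - c) = R" using z by (simp add: dist_norm norm_minus_commute)
      then have "Re (poly (smult (1/2) (p * q + r)) (z - c))
        = (Re (poly p (z - c) * poly q (z - c)) + Re (poly p (z - c) * cnj (poly q (z - c)))) / 2"
        using r by simp
      then show ?thesis using p[OF z] q[OF z] by simp
    qed
    then show "(\<lambda>z. g z * h z) \<in> Collect A" by (rule A)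
  next
    fix k :: real
    show "(\<lambda>_. k) \<in> Collect A" by (rule A[of _ "[:of_real k:]"]) simp
  next
    fix x y assume xy: "x \<in> sphere c R" "y \<in> sphere c R" "x \<noteq> y"
    have 1: "(\<lambda>z. Re (z - c)) \<in> Collect A"
      by (rule A[of _ "[:0, 1:]"]) simp
    have 2: "(\<lambda>z. Im (z - c)) \<in> Collect A"
      by (rule A[of _ "[:0, - \<i>:]"]) simp
    from xy(3) have "Re (x - c) \<noteq> Re (y - c) \<or> Im (x - c) \<noteq> Im (y - c)"
      by (auto simp: complex_eq_iff)
    then show "\<exists>f\<in>Collect A. f x \<noteq> f y"
      by (elim disjE) (erule bexI[OF _ 1], erule bexI[OF _ 2])
  qed
  from Stone_Weierstrass_basic[OF assms]
  obtain g where g: "A g" "\<forall>z\<in>sphere c R. \<bar>f z - g z\<bar> < e"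
    unfolding Bex_def mem_Collect_eq by (elim exE conjE)
  from g(1) obtain p where p: "\<forall>z\<in>sphere c R. g z = Re (poly p (z - c))"
    unfolding A_def by (elim exE)
  show ?thesis
  proof (intro exI[of _ p] ballI)
    fix z assume z: "z \<in> sphere c R"
    show "\<bar>f z - Re (poly p (z - c))\<bar> < e"
      using bspec[OF g(2) z] bspec[OF p z] by simp
  qed
qed

text \<open>
  The approximants are the inf-convolutions of the truncations \<open>min n g\<close> with \<open>n\<close> times the distance:
  they are \<open>n\<close>-Lipschitz, and they converge to \<open>g\<close> by lower semicontinuity.
\<close>

lemma lsc_increasing_continuous_approx:
  fixes g :: "'a::metric_space \<Rightarrow> ereal"
  assumes "S \<noteq> {}" "\<And>x. x \<in> S \<Longrightarrow> 0 \<le> g x" and usc: "upper_semicontinuous_on S (\<lambda>x. - g x)"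
  shows "\<exists>h :: nat \<Rightarrow> 'a \<Rightarrow> real. (\<forall>n. continuous_on UNIV (h n)) \<and> (\<forall>n x. x \<in> S \<longrightarrow> 0 \<le> h n x) \<and>
    (\<forall>m n x. m \<le> n \<longrightarrow> h m x \<le> h n x) \<and> (\<forall>x. x \<in> S \<longrightarrow> (SUP n. ereal (h n x)) = g x)"
proof -
  define G where "G n z = real_of_ereal (min (ereal (real n)) (max 0 (g z)))" for n z
  have G: "ereal (G n z) = min (ereal (real n)) (max 0 (g z))" for n z
    unfolding G_def by (cases "g z") (auto simp: min_def max_def)
  have G0: "0 \<le> G n z" for n z
  proof -
    have "0 \<le> ereal (G n z)" unfolding G by (simp add: le_max_iff_disj)
    then show ?thesis by simp
  qed
  have Gmono: "G m z \<le> G n z" if "m \<le> n" for m n z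
  proof -
    have "ereal (G m z) \<le> ereal (G n z)" unfolding G using that by (intro min.mono) auto
    then show ?thesis by simp
  qed
  define h where "h n y = (INF z\<in>S. G n z + real n * dist y z)" for n y
  have bdd: "bdd_below ((\<lambda>z. G n z + real n * dist y z) ` S)" for n y
    by (rule bdd_belowI[of _ 0]) (use G0 in auto)
  have lip: "h n x \<le> h n y + real n * dist x y" for n x y
  proof -
    have "h n x - real n * dist x y \<le> h n y"
      unfolding h_def[of n y]
    proof (rule cINF_greatest[OF assms(1)])
      fix z assume z: "z \<in> S"
      have "h n x \<le> G n z + real n * dist x z" unfolding h_def by (rule cINF_lower[OF bdd z])
      also have "\<dots> \<le> G n z + real n * (dist x y + dist y z)"
        by (intro add_left_mono mult_left_mono dist_triangle) auto
      finally show "h n x - real n * dist x y \<le> G n z + real n * dist y z"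
        by (simp add: algebra_simps)
    qed
    then show ?thesis by simp
  qed
  have cont: "continuous_on UNIV (h n)" for n
  proof -
    have "\<bar>h n x - h n y\<bar> \<le> real n * dist x y" for x y
      using lip[of n x y] lip[of n y x] by (simp add: dist_commute abs_le_iff)
    then have "(real n)-lipschitz_on UNIV (h n)"
      by (intro lipschitz_onI) (auto simp: dist_real_def)
    then show ?thesis by (rule lipschitz_on_continuous_on)
  qed
  have h0: "0 \<le> h n y" for n y
    unfolding h_def by (rule cINF_greatest[OF assms(1)]) (use G0 in auto)
  have mono: "h m x \<le> h n x" if "m \<le> n" for m n x
    unfolding h_def
  proof (rule cINF_mono[OF assms(1) bdd])
    fix z assume z: "z \<in> S"
    have "G m z + real m * dist x z \<le> G n z + real n * dist x z"
      using that Gmono[OF that] by (intro add_mono mult_right_mono) auto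
    then show "\<exists>y\<in>S. G m y + real m * dist x y \<le> G n z + real n * dist x z" using z by blast
  qed
  have sup: "(SUP n. ereal (h n x)) = g x" if x: "x \<in> S" for x
  proof (rule antisym)
    show "(SUP n. ereal (h n x)) \<le> g x"
    proof (rule SUP_least)
      fix n
      have "h n x \<le> G n x" using cINF_lower[OF bdd x, of n x] by (simp add: h_def)
      then have "ereal (h n x) \<le> ereal (G n x)" by simp
      also have "\<dots> \<le> g x" unfolding G using assms(2)[OF x] by (simp add: max_absorb2)
      finally show "ereal (h n x) \<le> g x" .
    qed
    show "g x \<le> (SUP n. ereal (h n x))"
    proof (rule ccontr)
      assume "\<not> ?thesis"
      then obtain a where a: "(SUP n. ereal (h n x)) < ereal a" "ereal a < g x"
        using ereal_dense2 by (metis not_le)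
      have a0: "0 < a"
      proof -
        have "ereal 0 \<le> ereal (h 0 x)" using h0 by simp
        also have "\<dots> \<le> (SUP n. ereal (h n x))" by (rule SUP_upper) simp
        finally show ?thesis using a(1) by (metis ereal_less(2) le_less_trans zero_ereal_def)
      qed
      have "- g x < - ereal a" using a(2) by (simp only: ereal_minus_less_minus)
      then have "\<forall>\<^sub>F y in at x within S. - g y < - ereal a"
        using usc x unfolding usc_iff_eventually by blast
      then obtain d where d: "d > 0" "\<And>y. y \<in> S \<Longrightarrow> y \<noteq> x \<Longrightarrow> dist y x < d \<Longrightarrow> - g y < - ereal a"
        unfolding eventually_at by blast
      have d': "ereal a \<le> g y" if "y \<in> S" "dist y x < d" for y
        using d(2)[OF that(1) _ that(2)] a(2)
        by (cases "y = x"; cases "g y") (auto simp: less_imp_le)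
      obtain n :: nat where n: "a \<le> real n" "a / d \<le> real n"
        using real_arch_simple[of "max a (a/d)"] by auto
      have "a \<le> h n x"
        unfolding h_def
      proof (rule cINF_greatest[OF assms(1)])
        fix z assume z: "z \<in> S"
        show "a \<le> G n z + real n * dist x z"
        proof (cases "dist z x < d")
          case True
          have "ereal a \<le> ereal (G n z)" unfolding G using d'[OF z True] n
            by (auto simp: le_max_iff_disj)
          then show ?thesis by (simp add: add_increasing2)
        next
          case False
          have "a = a / d * d" using d(1) by simp
          also have "\<dots> \<le> real n * dist x z"
            using False n d(1) a0 by (intro mult_mono) (auto simp: dist_commute)
          finally show ?thesis using G0[of n z] by simp
        qed
      qed
      then have "ereal a \<le> (SUP n. ereal (h n x))" by (intro SUP_upper2[of n]) auto
      then show False using a(1) by simp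
    qed
  qed
  show ?thesis by (intro exI[of _ h] conjI allI impI cont h0 mono sup)
qed

text \<open>
  With \<open>v \<le> B\<close> on the circle, let continuous \<open>h n\<close> increase to \<open>B - v\<close>. Since \<open>B - h n\<close> is
  continuous, it is uniformly close to the real part of a polynomial, so the hypothesis bounds the
  integral of \<open>h n\<close>; monotone convergence then bounds that of \<open>B - v\<close>. The rest of the proof
  translates this into the difference of the integrals of positive and negative parts of \<open>v\<close>.
\<close>

lemma le_circle_mean:
  assumes R: "0 < R" and usc: "upper_semicontinuous_on (sphere c R) v"
    and fin: "\<And>z. z \<in> sphere c R \<Longrightarrow> v z < \<infinity>"
    and maj: "\<And>p. (\<And>z. z \<in> sphere c R \<Longrightarrow> v z < ereal (Re (poly p (z - c))))
      \<Longrightarrow> v c \<le> ereal (Re (poly p 0))"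
  shows "v c \<le> circle_mean v c R"
proof (cases "v c")
  case MInf
  then show ?thesis by simp
next
  case PInf
  obtain B where B: "0 \<le> B" "\<And>z. z \<in> sphere c R \<Longrightarrow> v z \<le> ereal B"
    using usc_bounded_above[OF compact_sphere usc fin] by blast
  have "v c \<le> ereal (Re (poly [:of_real (B + 1):] 0))"
  proof (rule maj)
    fix z assume "z \<in> sphere c R"
    then have "v z \<le> ereal B" by (rule B)
    also have "ereal B < ereal (B + 1)" by simp
    finally show "v z < ereal (Re (poly [:of_real (B + 1):] (z - c)))" by simp
  qed
  with PInf show ?thesis by simp
next
  case (real r)
  obtain B where B: "0 \<le> B" "\<And>z. z \<in> sphere c R \<Longrightarrow> v z \<le> ereal B"
    using usc_bounded_above[OF compact_sphere usc fin] by blast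
  have ne: "sphere c R \<noteq> {}" using R by (simp add: not_less)
  have uscg: "upper_semicontinuous_on (sphere c R) (\<lambda>z. - (ereal B - v z))"
  proof -
    have "upper_semicontinuous_on (sphere c R) (\<lambda>z. v z + ereal (- B))"
      by (intro usc_add_continuous usc continuous_intros)
    moreover have "v z + ereal (- B) = - (ereal B - v z)" for z by (cases "v z") auto
    ultimately show ?thesis by simp
  qed
  have g0: "0 \<le> ereal B - v z" if "z \<in> sphere c R" for z
    using B(2)[OF that] fin[OF that] by (cases "v z") auto
  have "\<exists>h :: nat \<Rightarrow> complex \<Rightarrow> real. (\<forall>n. continuous_on UNIV (h n)) \<and> (\<forall>n x. x \<in> sphere c R \<longrightarrow> 0 \<le> h n x) \<and>
    (\<forall>m n x. m \<le> n \<longrightarrow> h m x \<le> h n x) \<and>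
    (\<forall>x. x \<in> sphere c R \<longrightarrow> (SUP n. ereal (h n x)) = ereal B - v x)"
    by (rule lsc_increasing_continuous_approx[OF ne _ uscg]) (rule g0)
  then obtain h :: "nat \<Rightarrow> complex \<Rightarrow> real" where "(\<forall>n. continuous_on UNIV (h n)) \<and> (\<forall>n x. x \<in> sphere c R \<longrightarrow> 0 \<le> h n x) \<and>
    (\<forall>m n x. m \<le> n \<longrightarrow> h m x \<le> h n x) \<and>
    (\<forall>x. x \<in> sphere c R \<longrightarrow> (SUP n. ereal (h n x)) = ereal B - v x)"
    by (elim exE)
  then have hc: "\<And>n. continuous_on UNIV (h n)" and h0: "\<And>n x. x \<in> sphere c R \<Longrightarrow> 0 \<le> h n x"
    and hm: "\<And>m n x. m \<le> n \<Longrightarrow> h m x \<le> h n x"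
    and hs: "\<And>x. x \<in> sphere c R \<Longrightarrow> (SUP n. ereal (h n x)) = ereal B - v x"
    by (elim conjE; simp)+
  define C where "C \<theta> = c + of_real R * cis \<theta>" for \<theta>
  have C: "C \<theta> \<in> sphere c R" for \<theta> using R by (simp add: C_def dist_norm norm_mult)
  have Cc: "continuous_on A C" for A unfolding C_def by (intro continuous_intros)
  have hCc: "continuous_on A (\<lambda>\<theta>. h n (C \<theta>))" for n A
    using continuous_on_compose2[OF hc Cc] by simp
  define F where "F \<theta> = v (C \<theta>)" for \<theta>
  have Fh: "F \<theta> = ereal B - (SUP n. ereal (h n (C \<theta>)))" for \<theta>
    unfolding F_def hs[OF C] using fin[OF C] by (cases "v (C \<theta>)") auto
  have Fm [measurable]: "F \<in> borel_measurable circle_measure"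
  proof -
    have "(\<lambda>\<theta>. h n (C \<theta>)) \<in> borel_measurable circle_measure" for n
      by (rule circle_measurable_continuous[OF hCc])
    then show ?thesis unfolding Fh[abs_def] by measurable
  qed
  have int_h: "integral\<^sup>L circle_measure (\<lambda>\<theta>. h n (C \<theta>)) \<le> 2 * pi * (B - r)" for n
  proof (rule field_le_epsilon)
    fix e :: real assume e: "0 < e"
    define d where "d = e / (2 * pi) / 2"
    have d: "0 < d" using e by (simp add: d_def)
    have "continuous_on (sphere c R) (\<lambda>z. B - h n z + d)"
      by (intro continuous_intros continuous_on_subset[OF hc subset_UNIV])
    \<comment> \<open>The shift by \<open>d\<close> puts the polynomial strictly above \<open>B - h n\<close>.\<close>
    from circle_approx_Re_poly[OF this d]
    obtain p where "\<forall>z\<in>sphere c R. \<bar>(B - h n z + d) - Re (poly p (z - c))\<bar> < d" by (elim exE)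
    note p = bspec[OF this]
    have "v c \<le> ereal (Re (poly p 0))"
    proof (rule maj)
      fix z assume z: "z \<in> sphere c R"
      have "ereal (h n z) \<le> ereal B - v z" unfolding hs[OF z, symmetric] by (rule SUP_upper) simp
      then have "v z \<le> ereal (B - h n z)" using fin[OF z] by (cases "v z") auto
      also have "ereal (B - h n z) < ereal (Re (poly p (z - c)))" using p[OF z] by (simp add: abs_less_iff)
      finally show "v z < ereal (Re (poly p (z - c)))" .
    qed
    then have "r \<le> Re (poly p 0)" using real by simp
    then have "2 * pi * r \<le> 2 * pi * Re (poly p 0)" by simp
    also have "\<dots> = integral\<^sup>L circle_measure (\<lambda>\<theta>. Re (poly p (of_real R * cis \<theta>)))"
      by (rule circle_integral_Re_poly[symmetric])
    also have "\<dots> \<le> integral\<^sup>L circle_measure (\<lambda>\<theta>. (B + 2 * d) - h n (C \<theta>))"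
    proof (rule integral_mono)
      show "integrable circle_measure (\<lambda>\<theta>. Re (poly p (of_real R * cis \<theta>)))"
        by (intro circle_integrable_continuous continuous_intros)
      show "integrable circle_measure (\<lambda>\<theta>. (B + 2 * d) - h n (C \<theta>))"
        by (intro circle_integrable_continuous continuous_intros hCc)
      fix \<theta> show "Re (poly p (of_real R * cis \<theta>)) \<le> (B + 2 * d) - h n (C \<theta>)"
        using p[OF C[of \<theta>]] by (simp add: C_def abs_less_iff)
    qed
    also have "\<dots> = 2 * pi * (B + 2 * d) - integral\<^sup>L circle_measure (\<lambda>\<theta>. h n (C \<theta>))"
    proof -
      have "integral\<^sup>L circle_measure (\<lambda>\<theta>. B + 2 * d) = 2 * pi * (B + 2 * d)"
        by (subst circle_lebesgue_integral[OF continuous_on_const, of _ "2 * pi * (B + 2 * d)"])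
          (use has_integral_const_real[of "B + 2 * d" 0 "2*pi"] in auto)
      then show ?thesis
        by (subst Bochner_Integration.integral_diff)
          (auto intro!: circle_integrable_continuous continuous_intros hCc)
    qed
    finally show "integral\<^sup>L circle_measure (\<lambda>\<theta>. h n (C \<theta>)) \<le> 2 * pi * (B - r) + e"
      by (simp add: d_def algebra_simps)
  qed
  have Br: "0 \<le> B - r"
  proof -
    have "0 \<le> integral\<^sup>L circle_measure (\<lambda>\<theta>. h 0 (C \<theta>))"
      by (intro integral_nonneg_AE AE_I2 h0 C)
    also have "\<dots> \<le> 2 * pi * (B - r)" by (rule int_h)
    finally show ?thesis using pi_gt_zero by (auto simp: zero_le_mult_iff)
  qed
  \<comment> \<open>By monotone convergence the bound passes to the limit \<open>B - v\<close>.\<close>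
  have int_g: "(\<integral>\<^sup>+\<theta>. e2ennreal (ereal B - F \<theta>) \<partial>circle_measure) \<le> ennreal (2 * pi * (B - r))"
  proof -
    have eq: "e2ennreal (ereal B - F \<theta>) = (SUP n. ennreal (h n (C \<theta>)))" for \<theta>
    proof -
      have "e2ennreal (ereal B - F \<theta>) = e2ennreal (SUP n. ereal (h n (C \<theta>)))"
        unfolding F_def hs[OF C] ..
      also have "\<dots> = (SUP n. e2ennreal (ereal (h n (C \<theta>))))"
        by (rule sup_continuousD[OF sup_continuous_e2ennreal])
          (auto simp: mono_def hm sup_continuous_def)
      finally show ?thesis by (simp add: ennreal.abs_eq)
    qed
    have "(\<integral>\<^sup>+\<theta>. e2ennreal (ereal B - F \<theta>) \<partial>circle_measure)
        = (SUP n. \<integral>\<^sup>+\<theta>. ennreal (h n (C \<theta>)) \<partial>circle_measure)"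
      unfolding eq
      by (rule nn_integral_monotone_convergence_SUP)
        (auto simp: incseq_def le_fun_def hm ennreal_leI intro!: measurable_compose[OF circle_measurable_continuous[OF hCc] measurable_ennreal])
    also have "\<dots> \<le> ennreal (2 * pi * (B - r))"
    proof (rule SUP_least)
      fix n
      have "(\<integral>\<^sup>+\<theta>. ennreal (h n (C \<theta>)) \<partial>circle_measure)
          = ennreal (integral\<^sup>L circle_measure (\<lambda>\<theta>. h n (C \<theta>)))"
        by (rule nn_integral_eq_integral) (auto intro!: circle_integrable_continuous hCc h0 C)
      then show "(\<integral>\<^sup>+\<theta>. ennreal (h n (C \<theta>)) \<partial>circle_measure) \<le> ennreal (2 * pi * (B - r))"
        using int_h[of n] by (simp add: ennreal_leI)
    qed
    finally show ?thesis .
  qed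
  define P where "P = (\<integral>\<^sup>+\<theta>. e2ennreal (F \<theta>) \<partial>circle_measure)"
  define N where "N = (\<integral>\<^sup>+\<theta>. e2ennreal (- F \<theta>) \<partial>circle_measure)"
  have FB: "F \<theta> \<le> ereal B" for \<theta> unfolding F_def using B(2) C by blast
  have int_B: "(\<integral>\<^sup>+\<theta>. ennreal B \<partial>circle_measure) = ennreal (2 * pi * B)"
  proof -
    have "(\<integral>\<^sup>+\<theta>. ennreal B \<partial>circle_measure) = ennreal B * ennreal (2 * pi)"
      by (simp add: emeasure_circle_measure)
    also have "\<dots> = ennreal (B * (2 * pi))" using B(1) by (simp add: ennreal_mult)
    also have "B * (2 * pi) = 2 * pi * B" by simp
    finally show ?thesis .
  qed
  \<comment> \<open>Both sides integrate \<open>B + max 0 (- F)\<close>; only nonnegative quantities are added, as \<open>F\<close> may take the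
    value \<open>- \<infinity>\<close>.\<close>
  have balance: "(\<integral>\<^sup>+\<theta>. e2ennreal (ereal B - F \<theta>) \<partial>circle_measure) + P
      = ennreal (2 * pi * B) + N"
  proof -
    have pw: "e2ennreal (ereal B - F \<theta>) + e2ennreal (F \<theta>) = ennreal B + e2ennreal (- F \<theta>)" for \<theta>
    proof (cases "F \<theta>")
      case (real x)
      have "x \<le> B" using FB[of \<theta>] real by simp
      then show ?thesis using real B(1)
        by (cases "0 \<le> x") (auto simp: ennreal.abs_eq[symmetric] ennreal_plus[symmetric] ennreal_neg simp del: ennreal_plus)
    next
      case PInf
      then show ?thesis using FB[of \<theta>] by simp
    next
      case MInf
      then show ?thesis by (simp add: e2ennreal_infty)
    qed
    have "(\<integral>\<^sup>+\<theta>. e2ennreal (ereal B - F \<theta>) \<partial>circle_measure) + P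
       = (\<integral>\<^sup>+\<theta>. e2ennreal (ereal B - F \<theta>) + e2ennreal (F \<theta>) \<partial>circle_measure)"
      unfolding P_def by (rule nn_integral_add[symmetric]) measurable
    also have "\<dots> = (\<integral>\<^sup>+\<theta>. ennreal B + e2ennreal (- F \<theta>) \<partial>circle_measure)" unfolding pw ..
    also have "\<dots> = (\<integral>\<^sup>+\<theta>. ennreal B \<partial>circle_measure) + N"
      unfolding N_def by (rule nn_integral_add) measurable
    finally show ?thesis unfolding int_B .
  qed
  have Pfin: "P \<le> ennreal (2 * pi * B)"
  proof -
    have "P \<le> (\<integral>\<^sup>+\<theta>. ennreal B \<partial>circle_measure)"
      unfolding P_def
      by (intro nn_integral_mono) (use FB e2ennreal_mono in \<open>fastforce simp: ennreal.abs_eq[symmetric]\<close>)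
    then show ?thesis unfolding int_B .
  qed
  obtain a where a: "0 \<le> a" "P = ennreal a" using Pfin by (cases P) (auto simp: top_unique)
  obtain k where k: "0 \<le> k" "(\<integral>\<^sup>+\<theta>. e2ennreal (ereal B - F \<theta>) \<partial>circle_measure) = ennreal k"
      "k \<le> 2 * pi * (B - r)"
    using int_g Br by (cases "\<integral>\<^sup>+\<theta>. e2ennreal (ereal B - F \<theta>) \<partial>circle_measure")
      (auto simp: top_unique)
  have "ennreal (k + a) = ennreal (2 * pi * B) + N" using balance a k by simp
  then obtain b where b: "0 \<le> b" "N = ennreal b" by (cases N) auto
  have "k + a = 2 * pi * B + b"
    using balance a b k B(1) by (simp add: ennreal_plus[symmetric] del: ennreal_plus)
  then have ab: "2 * pi * r \<le> a - b" using k(3) by (simp add: algebra_simps)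
  have "circle_mean v c R = ereal (1 / (2*pi)) * (enn2ereal P - enn2ereal N)"
    unfolding circle_mean_def ereal_integral_def P_def N_def F_def C_def ..
  also have "\<dots> = ereal ((a - b) / (2 * pi))" using a b by simp
  finally show ?thesis using ab real by (simp add: field_simps)
qed

section \<open>Second-order complex Taylor expansions\<close>

lemma scaleC_eq_scaleR:
  fixes x :: "'a::complex_vector"
  shows "c *\<^sub>C x = Re c *\<^sub>R x + Im c *\<^sub>R (\<i> *\<^sub>C x)"
proof -
  have "c *\<^sub>C x = (of_real (Re c) + of_real (Im c) * \<i>) *\<^sub>C x"
    using complex_eq[of c] by (simp add: mult.commute)
  also have "\<dots> = Re c *\<^sub>R x + Im c *\<^sub>R (\<i> *\<^sub>C x)"
    by (simp only: scaleC_add_left scaleC_of_real flip: scaleC_scaleC)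
  finally show ?thesis .
qed

lemma norm_scaleC_le:
  fixes x :: "'a::{complex_vector, real_normed_vector}"
  shows "norm (c *\<^sub>C x) \<le> cmod c * (norm x + norm (\<i> *\<^sub>C x))"
proof -
  have "norm (c *\<^sub>C x) \<le> \<bar>Re c\<bar> * norm x + \<bar>Im c\<bar> * norm (\<i> *\<^sub>C x)"
    by (subst scaleC_eq_scaleR) (metis norm_scaleR norm_triangle_ineq)
  also have "\<dots> \<le> cmod c * norm x + cmod c * norm (\<i> *\<^sub>C x)"
    by (intro add_mono mult_right_mono abs_Re_le_cmod abs_Im_le_cmod) auto
  finally show ?thesis by (simp add: algebra_simps)
qed

lemma tendsto_scaleC [tendsto_intros]:
  fixes b :: "'a::{complex_vector, real_normed_vector}"
  assumes "(f \<longlongrightarrow> c) F"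
  shows "((\<lambda>x. f x *\<^sub>C b) \<longlongrightarrow> c *\<^sub>C b) F"
proof -
  have "((\<lambda>x. Re (f x) *\<^sub>R b + Im (f x) *\<^sub>R (\<i> *\<^sub>C b)) \<longlongrightarrow> Re c *\<^sub>R b + Im c *\<^sub>R (\<i> *\<^sub>C b)) F"
    by (intro tendsto_intros assms)
  then show ?thesis by (simp only: scaleC_eq_scaleR[symmetric])
qed

lemma continuous_on_scaleC [continuous_intros]:
  fixes b :: "'a::{complex_vector, real_normed_vector}"
  assumes "continuous_on S f"
  shows "continuous_on S (\<lambda>x. f x *\<^sub>C b)"
proof -
  have "continuous_on S (\<lambda>x. Re (f x) *\<^sub>R b + Im (f x) *\<^sub>R (\<i> *\<^sub>C b))"
    by (intro continuous_intros assms)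
  then show ?thesis by (simp only: scaleC_eq_scaleR[symmetric])
qed

lemma scaleC_zero_left [simp]: "0 *\<^sub>C x = (0::'a::complex_vector)"
  using scaleC_of_real[of 0 x] by simp

lemma inner_scaleC:
  fixes y d :: "'a::{complex_vector, real_inner}"
  shows "y \<bullet> (c *\<^sub>C d) = Re (c * Complex (y \<bullet> d) (- (y \<bullet> (\<i> *\<^sub>C d))))"
  using arg_cong[OF scaleC_eq_scaleR[of c d], of "\<lambda>v. y \<bullet> v"] by (simp add: inner_add_right)

text \<open>
  A second-order expansion at one point is all that the maximum principle needs from a disc. Stated
  as a limit property, it passes to vectors and pairs componentwise.
\<close>

definition has_jet2 ::
  "(complex \<Rightarrow> 'a::{complex_vector, real_normed_vector}) \<Rightarrow> complex \<Rightarrow> 'a \<Rightarrow> 'a \<Rightarrow> bool" where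
  "has_jet2 f z b d \<longleftrightarrow> (\<forall>e>0. \<forall>\<^sub>F \<eta> in nhds 0.
     norm (f (z + \<eta>) - f z - \<eta> *\<^sub>C b - \<eta>\<^sup>2 *\<^sub>C d) \<le> e * (cmod \<eta>)\<^sup>2)"

lemma holomorphic_has_jet2:
  assumes "f holomorphic_on S" "open S" "z \<in> S"
  shows "\<exists>b d. has_jet2 f z b d"
proof -
  obtain r where r: "0 < r" "cball z r \<subseteq> S" using assms(2,3) open_contains_cball by blast
  define D where "D n = (deriv ^^ n) f" for n
  have D: "(D n has_field_derivative D (Suc n) w) (at w)" if "w \<in> S" for n w
    using holomorphic_derivI[OF holomorphic_higher_deriv[OF assms(1,2)] assms(2) that, of n UNIV]
    by (simp add: D_def)
  have D0: "D 0 = f" by (simp add: D_def)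
  have "D 3 holomorphic_on S" unfolding D_def by (rule holomorphic_higher_deriv[OF assms(1,2)])
  then have "continuous_on S (D 3)" by (rule holomorphic_on_imp_continuous_on)
  then have "continuous_on (cball z r) (D 3)" using r(2) by (rule continuous_on_subset)
  then have "bounded (D 3 ` cball z r)"
    by (intro compact_imp_bounded compact_continuous_image compact_cball)
  then obtain B where B: "0 < B" "\<And>w. w \<in> cball z r \<Longrightarrow> cmod (D 3 w) \<le> B"
    unfolding bounded_pos by blast
  have taylor: "cmod (f (z + \<eta>) - f z - \<eta> *\<^sub>C D 1 z - \<eta>\<^sup>2 *\<^sub>C (D 2 z / 2)) \<le> B * cmod \<eta> ^ 3 / 2"
    if "cmod \<eta> \<le> r" for \<eta>
  proof -
    have "cmod (D 0 (z + \<eta>) - (\<Sum>i\<le>2. D i z * ((z + \<eta>) - z) ^ i / fact i))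
        \<le> B * cmod ((z + \<eta>) - z) ^ Suc 2 / fact 2"
    proof (rule complex_Taylor[of "cball z r"])
      fix i x assume "x \<in> cball z r"
      then have "x \<in> S" using r(2) by blast
      then show "(D i has_field_derivative D (Suc i) x) (at x within cball z r)"
        using D has_field_derivative_at_within by blast
    next
      fix x assume "x \<in> cball z r"
      then show "cmod (D (Suc 2) x) \<le> B" using B(2) by (simp add: numeral_3_eq_3 numeral_2_eq_2)
    qed (use r that in \<open>auto simp: dist_norm\<close>)
    moreover have "(\<Sum>i\<le>2. D i z * ((z + \<eta>) - z) ^ i / fact i) = f z + \<eta> * D 1 z + \<eta>\<^sup>2 * (D 2 z / 2)"
      by (simp add: numeral_2_eq_2 D0 mult_ac)
    ultimately show ?thesis
      by (simp add: D0 scaleC_complex_def numeral_3_eq_3 numeral_2_eq_2 diff_diff_eq ac_simps)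
  qed
  have "has_jet2 f z (D 1 z) (D 2 z / 2)"
    unfolding has_jet2_def
  proof (intro allI impI)
    fix e :: real assume e: "0 < e"
    have "\<forall>\<^sub>F \<eta> in nhds 0. cmod \<eta> < min r (e / B)"
      unfolding eventually_nhds_metric using r e B
      by (intro exI[of _ "min r (e / B)"]) (auto simp: dist_norm)
    then show "\<forall>\<^sub>F \<eta> in nhds 0. cmod (f (z + \<eta>) - f z - \<eta> *\<^sub>C D 1 z - \<eta>\<^sup>2 *\<^sub>C (D 2 z / 2)) \<le> e * (cmod \<eta>)\<^sup>2"
    proof eventually_elim
      case (elim \<eta>)
      have "B * cmod \<eta> ^ 3 / 2 \<le> (B * cmod \<eta>) * (cmod \<eta>)\<^sup>2"
        using B(1) by (simp add: eval_nat_numeral)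
      also have "\<dots> \<le> e * (cmod \<eta>)\<^sup>2"
        using elim B(1) by (intro mult_right_mono) (auto simp: field_simps)
      finally show ?case using taylor[of \<eta>] elim by simp
    qed
  qed
  then show ?thesis by blast
qed

lemma has_jet2_affine: "has_jet2 (\<lambda>\<zeta>. a + \<zeta> *\<^sub>C b) z b (0::'a::{complex_vector, real_normed_vector})"
proof -
  have "a + (z + \<eta>) *\<^sub>C b - (a + z *\<^sub>C b) - \<eta> *\<^sub>C b - \<eta>\<^sup>2 *\<^sub>C 0 = 0" for \<eta>
    using scaleC_add_right[of "\<eta>\<^sup>2" 0 "0::'a"] by (simp add: scaleC_add_left)
  then show ?thesis unfolding has_jet2_def by simp
qed

lemma has_jet2_vec:
  fixes f :: "complex \<Rightarrow> complex ^ 'n"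
  assumes "\<And>i. has_jet2 (\<lambda>\<zeta>. f \<zeta> $ i) z (b $ i) (d $ i)"
  shows "has_jet2 f z b d"
  unfolding has_jet2_def
proof (intro allI impI)
  fix e :: real assume e: "0 < e"
  define e' where "e' = e / real CARD('n)"
  have e': "0 < e'" using e by (simp add: e'_def)
  have "\<forall>\<^sub>F \<eta> in nhds 0. \<forall>i. cmod (f (z + \<eta>) $ i - f z $ i - \<eta> *\<^sub>C (b $ i) - \<eta>\<^sup>2 *\<^sub>C (d $ i)) \<le> e' * (cmod \<eta>)\<^sup>2"
    by (rule eventually_all_finite) (use assms e' in \<open>auto simp: has_jet2_def\<close>)
  then show "\<forall>\<^sub>F \<eta> in nhds 0. norm (f (z + \<eta>) - f z - \<eta> *\<^sub>C b - \<eta>\<^sup>2 *\<^sub>C d) \<le> e * (cmod \<eta>)\<^sup>2"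
  proof eventually_elim
    case (elim \<eta>)
    have "norm (f (z + \<eta>) - f z - \<eta> *\<^sub>C b - \<eta>\<^sup>2 *\<^sub>C d)
       \<le> (\<Sum>i\<in>UNIV. cmod (f (z + \<eta>) $ i - f z $ i - \<eta> *\<^sub>C (b $ i) - \<eta>\<^sup>2 *\<^sub>C (d $ i)))"
      unfolding norm_vec_def by (rule order_trans[OF L2_set_le_sum]) (auto simp: scaleC_vec_def)
    also have "\<dots> \<le> (\<Sum>i\<in>(UNIV::'n set). e' * (cmod \<eta>)\<^sup>2)" using elim by (intro sum_mono) auto
    also have "\<dots> = e * (cmod \<eta>)\<^sup>2" by (simp add: e'_def)
    finally show ?case .
  qed
qed

lemma has_jet2_Pair:
  assumes "has_jet2 f z b d" "has_jet2 g z b' d'"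
  shows "has_jet2 (\<lambda>\<zeta>. (f \<zeta>, g \<zeta>)) z (b, b') (d, d')"
  unfolding has_jet2_def
proof (intro allI impI)
  fix e :: real assume e: "0 < e"
  have "\<forall>\<^sub>F \<eta> in nhds 0. norm (f (z + \<eta>) - f z - \<eta> *\<^sub>C b - \<eta>\<^sup>2 *\<^sub>C d) \<le> (e/2) * (cmod \<eta>)\<^sup>2"
    "\<forall>\<^sub>F \<eta> in nhds 0. norm (g (z + \<eta>) - g z - \<eta> *\<^sub>C b' - \<eta>\<^sup>2 *\<^sub>C d') \<le> (e/2) * (cmod \<eta>)\<^sup>2"
    using assms e unfolding has_jet2_def by (meson half_gt_zero)+
  then show "\<forall>\<^sub>F \<eta> in nhds 0. norm ((f (z + \<eta>), g (z + \<eta>)) - (f z, g z) - \<eta> *\<^sub>C (b, b') - \<eta>\<^sup>2 *\<^sub>C (d, d'))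
      \<le> e * (cmod \<eta>)\<^sup>2"
  proof eventually_elim
    case (elim \<eta>)
    have "norm ((f (z + \<eta>), g (z + \<eta>)) - (f z, g z) - \<eta> *\<^sub>C (b, b') - \<eta>\<^sup>2 *\<^sub>C (d, d'))
        \<le> norm (f (z + \<eta>) - f z - \<eta> *\<^sub>C b - \<eta>\<^sup>2 *\<^sub>C d) + norm (g (z + \<eta>) - g z - \<eta> *\<^sub>C b' - \<eta>\<^sup>2 *\<^sub>C d')"
      by (simp add: scaleC_prod_def norm_Pair_le)
    also have "\<dots> \<le> e * (cmod \<eta>)\<^sup>2" using elim by (simp add: field_simps)
    finally show ?case .
  qed
qed

text \<open>
  Moving the point \<open>f z + y\<close> along the complex tangent of \<open>f\<close> at \<open>z\<close> keeps its offset from \<open>f (z + \<eta>)\<close>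
  equal to \<open>y\<close> up to \<open>\<eta>\<^sup>2 d\<close>, so the squared length changes, up to \<open>o(|\<eta>|\<^sup>2)\<close>, by the real part of a
  multiple of \<open>\<eta>\<^sup>2\<close>, which is harmonic in \<open>\<eta>\<close>.
\<close>

lemma has_jet2_norm_square:
  fixes f :: "complex \<Rightarrow> 'a::{complex_vector, real_inner}"
  assumes "has_jet2 f z b d" "0 < e"
  shows "\<forall>\<^sub>F \<eta> in nhds 0. (norm (y + \<eta> *\<^sub>C b - (f (z + \<eta>) - f z)))\<^sup>2
      \<le> (norm y)\<^sup>2 - 2 * (y \<bullet> (\<eta>\<^sup>2 *\<^sub>C d)) + e * (cmod \<eta>)\<^sup>2"
proof -
  define D where "D = norm d + norm (\<i> *\<^sub>C d)"
  define e0 where "e0 = e / (4 * (norm y + 1))"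
  have D: "0 \<le> D" by (simp add: D_def)
  have e0: "0 < e0" using assms(2) by (simp add: e0_def add_nonneg_pos)
  have e0': "2 * norm y * e0 \<le> e / 2"
  proof -
    have n: "0 < norm y + 1" by (simp add: add_nonneg_pos)
    then have "2 * norm y * e0 = e / 2 * (norm y / (norm y + 1))" by (simp add: e0_def field_simps)
    also have "\<dots> \<le> e / 2 * 1" using n assms(2) by (intro mult_left_mono) auto
    finally show ?thesis by simp
  qed
  define s where "s = e / (2 * (D + e0)\<^sup>2)"
  have s: "0 < s" using D e0 assms(2) by (simp add: s_def)
  have 1: "\<forall>\<^sub>F \<eta> in nhds 0. norm (f (z + \<eta>) - f z - \<eta> *\<^sub>C b - \<eta>\<^sup>2 *\<^sub>C d) \<le> e0 * (cmod \<eta>)\<^sup>2"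
    using assms(1) e0 unfolding has_jet2_def by blast
  have "((\<lambda>\<eta>. (cmod \<eta>)\<^sup>2) \<longlongrightarrow> 0) (nhds 0)"
    by (rule tendsto_eq_intros filterlim_ident refl | simp)+
  then have 2: "\<forall>\<^sub>F \<eta> in nhds 0. (cmod \<eta>)\<^sup>2 < s" using s by (rule order_tendstoD)
  show ?thesis using 1 2
  proof eventually_elim
    case (elim \<eta>)
    define R where "R = f (z + \<eta>) - f z - \<eta> *\<^sub>C b - \<eta>\<^sup>2 *\<^sub>C d"
    define t where "t = (cmod \<eta>)\<^sup>2"
    define E where "E = \<eta>\<^sup>2 *\<^sub>C d"
    have t: "0 \<le> t" "t < s" using elim by (auto simp: t_def)
    have R: "norm R \<le> e0 * t" using elim by (simp add: R_def t_def)
    have E: "norm E \<le> D * t" using norm_scaleC_le[of "\<eta>\<^sup>2" d]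
      by (simp add: E_def D_def t_def norm_power mult.commute)
    have ER: "norm (E + R) \<le> (D + e0) * t"
      using norm_triangle_ineq[of E R] E R by (simp add: algebra_simps)
    have "(norm (E + R))\<^sup>2 \<le> ((D + e0) * t)\<^sup>2" using ER by (intro power_mono) auto
    also have "\<dots> = ((D + e0)\<^sup>2 * t) * t" by (simp add: power2_eq_square)
    also have "\<dots> \<le> (e / 2) * t"
    proof (rule mult_right_mono)
      have "(D + e0)\<^sup>2 * t \<le> (D + e0)\<^sup>2 * s" using t by (intro mult_left_mono) auto
      also have "\<dots> = e / 2" using D e0 by (simp add: s_def)
      finally show "(D + e0)\<^sup>2 * t \<le> e / 2" .
    qed (use t in auto)
    finally have ER2: "(norm (E + R))\<^sup>2 \<le> (e / 2) * t" .
    have "- (y \<bullet> R) \<le> norm y * norm R" using Cauchy_Schwarz_ineq2[of y R] by linarith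
    also have "\<dots> \<le> norm y * (e0 * t)" using R by (intro mult_left_mono) auto
    finally have "- 2 * (y \<bullet> R) \<le> (2 * norm y * e0) * t" by (simp add: mult_ac)
    also have "\<dots> \<le> (e / 2) * t" using e0' t by (intro mult_right_mono) auto
    finally have yR: "- 2 * (y \<bullet> R) \<le> (e / 2) * t" .
    have eq: "y + \<eta> *\<^sub>C b - (f (z + \<eta>) - f z) = y - (E + R)" by (simp add: R_def E_def)
    have "(norm (y + \<eta> *\<^sub>C b - (f (z + \<eta>) - f z)))\<^sup>2 = (norm y)\<^sup>2 - 2 * (y \<bullet> E) - 2 * (y \<bullet> R) + (norm (E + R))\<^sup>2"
      unfolding eq
      by (simp add: power2_norm_eq_inner inner_diff_left inner_diff_right inner_add_left inner_add_right inner_commute)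
    also have "\<dots> \<le> (norm y)\<^sup>2 - 2 * (y \<bullet> E) + e * t" using yR ER2 by simp
    finally show ?case by (simp add: E_def t_def)
  qed
qed

section \<open>The maximum principle along holomorphic discs\<close>

text \<open>
  The trace of plurisubharmonicity that is used below: comparison, on affine discs, with real parts
  of polynomials of degree two.
\<close>

definition quad_submean :: "'a::complex_vector set \<Rightarrow> ('a \<Rightarrow> ereal) \<Rightarrow> bool" where
  "quad_submean S \<phi> \<longleftrightarrow> (\<forall>x b \<rho> A B C. 0 < \<rho> \<longrightarrow>
     (\<forall>\<eta>. cmod \<eta> \<le> \<rho> \<longrightarrow> x + \<eta> *\<^sub>C b \<in> S) \<longrightarrow>
     (\<forall>\<eta>. cmod \<eta> = \<rho> \<longrightarrow> \<phi> (x + \<eta> *\<^sub>C b) \<le> ereal (Re (A + B * \<eta> + C * \<eta>\<^sup>2))) \<longrightarrow>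
     \<phi> x \<le> ereal (Re A))"

lemma plurisubharmonic_imp_quad_submean:
  fixes \<phi> :: "'a::{complex_vector, real_normed_vector} \<Rightarrow> ereal"
  assumes "plurisubharmonic_on S \<phi>"
  shows "quad_submean S \<phi>"
  unfolding quad_submean_def
proof (intro allI impI)
  fix x b :: 'a and \<rho> :: real and A B C :: complex
  assume \<rho>: "0 < \<rho>" and disc: "\<forall>\<eta>. cmod \<eta> \<le> \<rho> \<longrightarrow> x + \<eta> *\<^sub>C b \<in> S"
    and le: "\<forall>\<eta>. cmod \<eta> = \<rho> \<longrightarrow> \<phi> (x + \<eta> *\<^sub>C b) \<le> ereal (Re (A + B * \<eta> + C * \<eta>\<^sup>2))"
  have "subharmonic_on {\<zeta>. x + \<zeta> *\<^sub>C b \<in> S} (\<lambda>\<zeta>. \<phi> (x + \<zeta> *\<^sub>C b))"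
    using assms unfolding plurisubharmonic_on_def by blast
  moreover have "cball 0 \<rho> \<subseteq> {\<zeta>. x + \<zeta> *\<^sub>C b \<in> S}" using disc by auto
  ultimately have "\<phi> (x + 0 *\<^sub>C b) \<le> ereal (Re (poly [:A, B, C:] 0))"
  proof (rule subharmonic_le_Re_poly[OF _ \<rho>])
    fix \<eta> :: complex assume "\<eta> \<in> sphere 0 \<rho>"
    then have "\<phi> (x + \<eta> *\<^sub>C b) \<le> ereal (Re (A + B * \<eta> + C * \<eta>\<^sup>2))" using le by simp
    also have "A + B * \<eta> + C * \<eta>\<^sup>2 = poly [:A, B, C:] (\<eta> - 0)"
      by (simp add: algebra_simps power2_eq_square)
    finally show "\<phi> (x + \<eta> *\<^sub>C b) \<le> ereal (Re (poly [:A, B, C:] (\<eta> - 0)))" .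
  qed
  then show "\<phi> x \<le> ereal (Re A)" by simp
qed

text \<open>
  The function \<open>\<phi> \<circ> f\<close> is compared with \<open>Re q\<close> on \<open>K\<close>. Since only affine discs may be tested, the
  variables are doubled: \<open>\<phi>\<close> is evaluated at a point \<open>f z + y\<close> near the curve and the penalty
  \<open>k * |y|\<^sup>2\<close> keeps \<open>y\<close> small. If the bound fails, then for large \<open>k\<close> the penalized difference, strengthened
  by \<open>\<epsilon> * |z|\<^sup>2\<close>, is maximal at some \<open>(z, y)\<close> with \<open>z\<close> in the interior of \<open>K\<close>. Moving \<open>z\<close> to
  \<open>z + \<eta>\<close> and the point \<open>f z + y\<close> along the affine disc with direction \<open>f' z\<close> changes the penalty and
  \<open>Re q\<close> only by harmonic terms and \<open>o(|\<eta>|\<^sup>2)\<close>, whereas \<open>\<epsilon> * |z + \<eta>|\<^sup>2\<close> gains \<open>\<epsilon> * |\<eta>|\<^sup>2\<close> in the mean.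
  This contradicts the submean inequality for \<open>\<phi>\<close> on the affine disc.
\<close>

lemma disc_maximum_principle:
  fixes \<phi> :: "'a::{complex_vector, euclidean_space} \<Rightarrow> ereal"
  assumes psh: "plurisubharmonic_on S \<phi>"
    and K: "compact K" and f: "continuous_on K f" "f ` K \<subseteq> S"
    and fjet: "\<And>z. z \<in> interior K \<Longrightarrow> \<exists>b d. has_jet2 f z b d"
    and q: "continuous_on K q" and qjet: "\<And>z. z \<in> interior K \<Longrightarrow> \<exists>b d. has_jet2 q z b d"
    and bdry: "\<And>z. z \<in> frontier K \<Longrightarrow> \<phi> (f z) \<le> ereal (Re (q z))"
    and w: "w \<in> K"
  shows "\<phi> (f w) \<le> ereal (Re (q w))"
proof (rule ccontr)
  have S: "open S" and fin: "\<And>x. x \<in> S \<Longrightarrow> \<phi> x < \<infinity>" and usc: "upper_semicontinuous_on S \<phi>"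
    using psh unfolding plurisubharmonic_on_def by blast+
  have sub: "quad_submean S \<phi>" by (rule plurisubharmonic_imp_quad_submean[OF psh])
  assume "\<not> ?thesis"
  then obtain r where r: "ereal (Re (q w)) < ereal r" "ereal r < \<phi> (f w)"
    using ereal_dense2 by (metis not_le)
  define \<gamma> where "\<gamma> = r - Re (q w)"
  have \<gamma>: "0 < \<gamma>" using r(1) by (simp add: \<gamma>_def)
  obtain B where B: "0 < B" "\<And>z. z \<in> K \<Longrightarrow> cmod z \<le> B"
    using compact_imp_bounded[OF K] by (auto simp: bounded_pos)
  define \<epsilon> where "\<epsilon> = \<gamma> / (2 * B\<^sup>2)"
  have \<epsilon>: "0 < \<epsilon>" using \<gamma> B by (simp add: \<epsilon>_def)
  \<comment> \<open>A strictly superharmonic majorant of \<open>Re q\<close> on \<open>K\<close>, with \<open>\<epsilon>\<close> so small that it does not reach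
    \<open>\<phi> (f w)\<close> at \<open>w\<close>.\<close>
  define \<psi> where "\<psi> z = Re (q z) + \<epsilon> * (B\<^sup>2 - (cmod z)\<^sup>2)" for z
  have \<psi>_ge: "Re (q z) \<le> \<psi> z" if "z \<in> K" for z
    using B(2)[OF that] \<epsilon> by (simp add: \<psi>_def power_mono)
  have \<psi>w: "\<psi> w \<le> r - \<gamma> / 2"
  proof -
    have "\<epsilon> * (B\<^sup>2 - (cmod w)\<^sup>2) \<le> \<epsilon> * B\<^sup>2" using \<epsilon> by (intro mult_left_mono) auto
    also have "\<dots> = \<gamma> / 2" using B by (simp add: \<epsilon>_def)
    finally show ?thesis unfolding \<psi>_def using \<gamma>_def by linarith
  qed
  have \<psi>c: "continuous_on K \<psi>" unfolding \<psi>_def by (intro continuous_intros q)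
  have "compact (f ` K)" using K f(1) compact_continuous_image by blast
  then obtain \<delta> where \<delta>: "0 < \<delta>" "(\<Union>x\<in>f ` K. cball x \<delta>) \<subseteq> S"
    using compact_subset_open_imp_cball_epsilon_subset[OF _ S f(2)] by blast
  define Q where "Q = K \<times> cball (0::'a) \<delta>"
  have Q: "compact Q" unfolding Q_def by (intro compact_Times K compact_cball)
  have inS: "f (fst p) + snd p \<in> S" if "p \<in> Q" for p
  proof -
    have "f (fst p) + snd p \<in> cball (f (fst p)) \<delta>" using that by (auto simp: Q_def dist_norm)
    moreover have "fst p \<in> K" using that by (auto simp: Q_def)
    ultimately show ?thesis using \<delta>(2) by blast
  qed
  have fc: "continuous_on Q (\<lambda>p. f (fst p))"
    by (rule continuous_on_compose2[OF f(1)]) (auto simp: Q_def intro!: continuous_intros)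
  have \<psi>Qc: "continuous_on Q (\<lambda>p. \<psi> (fst p))"
    by (rule continuous_on_compose2[OF \<psi>c]) (auto simp: Q_def intro!: continuous_intros)
  define H where "H p = \<phi> (f (fst p) + snd p) + ereal (- \<psi> (fst p))" for p
  have Hfin: "H p < \<infinity>" if "p \<in> Q" for p
    using fin[OF inS[OF that]] by (cases "\<phi> (f (fst p) + snd p)") (auto simp: H_def)
  have Husc: "upper_semicontinuous_on Q H"
    unfolding H_def
  proof (intro usc_add_continuous continuous_intros \<psi>Qc)
    show "upper_semicontinuous_on Q (\<lambda>p. \<phi> (f (fst p) + snd p))"
      by (rule usc_compose[OF usc]) (use inS in \<open>auto intro!: continuous_intros fc\<close>)
  qed
  obtain M where M: "0 \<le> M" "\<And>p. p \<in> Q \<Longrightarrow> H p \<le> ereal M"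
    by (rule usc_bounded_above[OF Q Husc Hfin]) blast+
  \<comment> \<open>Over the frontier of \<open>K\<close>, the superlevel set of \<open>H\<close> that contains the maximum point avoids
    \<open>y = 0\<close>, hence a whole ball around it.\<close>
  define E where "E = {p \<in> Q. ereal (\<gamma> / 2) \<le> H p} \<inter> (frontier K \<times> cball 0 \<delta>)"
  have E: "compact E" unfolding E_def
    by (intro compact_Int usc_closed_superlevel Q Husc compact_Times compact_frontier K compact_cball)
  have E0: "0 \<notin> snd ` E"
  proof
    assume "0 \<in> snd ` E"
    then obtain z where z: "(z, 0) \<in> E" by force
    then have zf: "z \<in> frontier K" "ereal (\<gamma> / 2) \<le> H (z, 0)" by (auto simp: E_def)
    have zK: "z \<in> K" using z by (auto simp: E_def Q_def)
    have "\<phi> (f z) \<le> ereal (\<psi> z)" using bdry[OF zf(1)] \<psi>_ge[OF zK] by (meson ereal_less_eq(3) order_trans)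
    then have "H (z, 0) \<le> 0" by (cases "\<phi> (f z)") (auto simp: H_def)
    with zf(2) have "ereal (\<gamma> / 2) \<le> 0" by (rule order_trans)
    then show False using \<gamma> by simp
  qed
  have "open (- (snd ` E))"
    by (intro open_Compl compact_imp_closed compact_continuous_image E continuous_intros)
  with E0 obtain \<delta>' where \<delta>': "0 < \<delta>'" "ball 0 \<delta>' \<subseteq> - (snd ` E)"
    by (meson ComplI open_contains_ball)
  define \<delta>1 where "\<delta>1 = min \<delta> \<delta>'"
  have \<delta>1: "0 < \<delta>1" using \<delta> \<delta>' by (simp add: \<delta>1_def)
  define k where "k = (M + 1) / \<delta>1\<^sup>2"
  have k: "0 < k" "k * \<delta>1\<^sup>2 = M + 1" using \<delta>1 M(1) by (auto simp: k_def add_nonneg_pos)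
  have ne: "Q \<noteq> {}" using w \<delta>(1) by (auto simp: Q_def)
  have "upper_semicontinuous_on Q (\<lambda>p. H p + ereal (- k * (norm (snd p))\<^sup>2))"
    by (intro usc_add_continuous Husc continuous_intros)
  from usc_attains_sup[OF Q ne this]
  obtain p where p: "p \<in> Q" and pmax: "\<And>p'. p' \<in> Q \<Longrightarrow>
      H p' + ereal (- k * (norm (snd p'))\<^sup>2) \<le> H p + ereal (- k * (norm (snd p))\<^sup>2)" by metis
  obtain z y where zy: "p = (z, y)" by (cases p)
  have zK: "z \<in> K" and y\<delta>: "norm y \<le> \<delta>" using p by (auto simp: zy Q_def)
  have "ereal (\<gamma> / 2) \<le> H (w, 0)"
  proof -
    have "ereal (\<psi> w + \<gamma> / 2) \<le> \<phi> (f w)" using \<psi>w r(2) by (meson add_le_imp_le_diff ereal_less_eq(3) le_diff_eq less_imp_le order_trans)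
    then show ?thesis by (cases "\<phi> (f w)") (auto simp: H_def)
  qed
  also have "H (w, 0) = H (w, 0) + ereal (- k * (norm (snd (w, 0::'a)))\<^sup>2)" by (simp add: zero_ereal_def[symmetric])
  also have "\<dots> \<le> H p + ereal (- k * (norm (snd p))\<^sup>2)"
    by (rule pmax) (use w \<delta>(1) in \<open>auto simp: Q_def\<close>)
  finally have top: "ereal (\<gamma> / 2) \<le> H (z, y) + ereal (- k * (norm y)\<^sup>2)" by (simp add: zy)
  obtain F where F: "\<phi> (f z + y) = ereal F"
    using top fin[OF inS[OF p]] by (cases "\<phi> (f z + y)") (auto simp: H_def zy)
  have HF: "H (z, y) = ereal (F - \<psi> z)" by (simp add: H_def F)
  have top': "\<gamma> / 2 + k * (norm y)\<^sup>2 \<le> F - \<psi> z" using top by (simp add: HF)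
  have "F - \<psi> z \<le> M" using M(2)[OF p] by (simp add: zy HF)
  then have "k * (norm y)\<^sup>2 < k * \<delta>1\<^sup>2" using top' \<gamma> k by simp
  then have "(norm y)\<^sup>2 < \<delta>1\<^sup>2" using k(1) by (simp only: mult_less_cancel_left_pos)
  then have y: "norm y < \<delta>1" using \<delta>1 by (rule power2_less_imp_less[OF _ less_imp_le])
  have "z \<notin> frontier K"
  proof
    assume "z \<in> frontier K"
    moreover have "\<gamma> / 2 \<le> F - \<psi> z"
      using top' mult_nonneg_nonneg[OF less_imp_le[OF k(1)] zero_le_power2[of "norm y"]] by linarith
    ultimately have "(z, y) \<in> E" using p y\<delta> by (simp add: E_def zy HF)
    then have "y \<in> snd ` E" by (metis image_eqI snd_conv)
    moreover have "y \<in> ball 0 \<delta>'" using y by (simp add: \<delta>1_def)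
    ultimately show False using \<delta>'(2) by blast
  qed
  with zK have zint: "z \<in> interior K"
    using compact_imp_closed[OF K] by (simp add: frontier_def)
  obtain b d where fj: "has_jet2 f z b d" using fjet[OF zint] by blast
  obtain b' d' where qj: "has_jet2 q z b' d'" using qjet[OF zint] by blast
  \<comment> \<open>From here on \<open>z\<close> moves to \<open>z + \<eta>\<close> and the point \<open>x = f z + y\<close> to \<open>x + \<eta> b\<close>, where \<open>b\<close> is the
    derivative of \<open>f\<close> at \<open>z\<close>.\<close>
  have ev1: "\<forall>\<^sub>F \<eta> in nhds 0. z + \<eta> \<in> interior K"
  proof -
    have "((\<lambda>\<eta>. z + \<eta>) \<longlongrightarrow> z) (nhds 0)"
      by (rule tendsto_eq_intros filterlim_ident refl | simp)+
    then show ?thesis using zint by (rule topological_tendstoD[OF _ open_interior])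
  qed
  have ev2: "\<forall>\<^sub>F \<eta> in nhds 0. norm (y + \<eta> *\<^sub>C b - (f (z + \<eta>) - f z)) < \<delta>"
  proof -
    have "isCont f z" using f(1) zint by (metis continuous_on_interior)
    then have ft: "((\<lambda>\<eta>. f (z + \<eta>)) \<longlongrightarrow> f z) (nhds 0)"
      by (intro isCont_tendsto_compose[of z f]) (rule tendsto_eq_intros filterlim_ident refl | simp)+
    have "((\<lambda>\<eta>. norm (y + \<eta> *\<^sub>C b - (f (z + \<eta>) - f z))) \<longlongrightarrow> norm (y + 0 *\<^sub>C b - (f z - f z))) (nhds 0)"
      by (intro tendsto_intros ft filterlim_ident)
    then show ?thesis using y by (intro order_tendstoD) (auto simp: \<delta>1_def)
  qed
  define e2 where "e2 = \<epsilon> / (4 * k)"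
  have e2: "0 < e2" using \<epsilon> k by (simp add: e2_def)
  have "0 < \<epsilon> / 4" using \<epsilon> by simp
  then have ev3: "\<forall>\<^sub>F \<eta> in nhds 0. cmod (q (z + \<eta>) - q z - \<eta> *\<^sub>C b' - \<eta>\<^sup>2 *\<^sub>C d') \<le> \<epsilon> / 4 * (cmod \<eta>)\<^sup>2"
    using qj unfolding has_jet2_def by blast
  from eventually_conj[OF eventually_conj[OF ev1 ev2] eventually_conj[OF ev3 has_jet2_norm_square[OF fj e2, of y]]]
  obtain \<rho>0 where \<rho>0: "0 < \<rho>0" and near: "\<And>\<eta>. cmod \<eta> < \<rho>0 \<Longrightarrow>
      (z + \<eta> \<in> interior K \<and> norm (y + \<eta> *\<^sub>C b - (f (z + \<eta>) - f z)) < \<delta>) \<and>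
      cmod (q (z + \<eta>) - q z - \<eta> *\<^sub>C b' - \<eta>\<^sup>2 *\<^sub>C d') \<le> \<epsilon> / 4 * (cmod \<eta>)\<^sup>2 \<and>
      (norm (y + \<eta> *\<^sub>C b - (f (z + \<eta>) - f z)))\<^sup>2
        \<le> (norm y)\<^sup>2 - 2 * (y \<bullet> (\<eta>\<^sup>2 *\<^sub>C d)) + e2 * (cmod \<eta>)\<^sup>2"
    unfolding eventually_nhds_metric dist_norm diff_zero by blast
  define \<rho> where "\<rho> = \<rho>0 / 2"
  have \<rho>: "0 < \<rho>" "\<rho> < \<rho>0" using \<rho>0 by (auto simp: \<rho>_def)
  define \<kappa> where "\<kappa> = Complex (y \<bullet> d) (- (y \<bullet> (\<i> *\<^sub>C d)))"
  define x where "x = f z + y"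
  have shift: "f (z + \<eta>) + (y + \<eta> *\<^sub>C b - (f (z + \<eta>) - f z)) = x + \<eta> *\<^sub>C b" for \<eta>
    by (simp add: x_def)
  have inQ: "(z + \<eta>, y + \<eta> *\<^sub>C b - (f (z + \<eta>) - f z)) \<in> Q" if "cmod \<eta> < \<rho>0" for \<eta>
    using near[OF that] interior_subset by (auto simp: Q_def)
  have "\<phi> x \<le> ereal (Re (of_real (F - \<epsilon> / 2 * \<rho>\<^sup>2)))"
  proof (rule sub[unfolded quad_submean_def, rule_format])
    show "0 < \<rho>" by (rule \<rho>)
  next
    fix \<eta> :: complex assume "cmod \<eta> \<le> \<rho>"
    then have "cmod \<eta> < \<rho>0" using \<rho> by simp
    from inS[OF inQ[OF this]] show "x + \<eta> *\<^sub>C b \<in> S" by (simp only: fst_conv snd_conv shift)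
  next
    fix \<eta> :: complex assume \<eta>: "cmod \<eta> = \<rho>"
    then have \<eta>0: "cmod \<eta> < \<rho>0" using \<rho> by simp
    define y' where "y' = y + \<eta> *\<^sub>C b - (f (z + \<eta>) - f z)"
    have "H (z + \<eta>, y') + ereal (- k * (norm y')\<^sup>2) \<le> ereal (F - \<psi> z - k * (norm y)\<^sup>2)"
      using pmax[OF inQ[OF \<eta>0]] by (simp add: zy HF y'_def)
    then have 1: "\<phi> (x + \<eta> *\<^sub>C b) \<le> ereal (F - \<psi> z - k * (norm y)\<^sup>2 + \<psi> (z + \<eta>) + k * (norm y')\<^sup>2)"
      unfolding H_def using shift[of \<eta>]
      by (cases "\<phi> (x + \<eta> *\<^sub>C b)") (auto simp: y'_def)
    \<comment> \<open>Names for the harmonic terms, which the estimate treats as atoms.\<close>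
    define X1 where "X1 = Re (\<eta>\<^sup>2 * \<kappa>)"
    define X2 where "X2 = Re (\<eta> * b')"
    define X3 where "X3 = Re (\<eta>\<^sup>2 * d')"
    define X4 where "X4 = Re (cnj z * \<eta>)"
    have yd: "y \<bullet> (\<eta>\<^sup>2 *\<^sub>C d) = X1" unfolding X1_def \<kappa>_def by (rule inner_scaleC)
    have "(norm y')\<^sup>2 \<le> (norm y)\<^sup>2 - 2 * X1 + e2 * \<rho>\<^sup>2"
      using near[OF \<eta>0] \<eta> unfolding y'_def yd by blast
    then have "k * (norm y')\<^sup>2 \<le> k * ((norm y)\<^sup>2 - 2 * X1 + e2 * \<rho>\<^sup>2)"
      using k(1) by (intro mult_left_mono) auto
    also have "\<dots> = k * (norm y)\<^sup>2 - 2 * k * X1 + (k * e2) * \<rho>\<^sup>2"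
      by (simp add: algebra_simps)
    also have "k * e2 = \<epsilon> / 4" using k(1) by (simp add: e2_def)
    finally have 2: "k * (norm y')\<^sup>2 \<le> k * (norm y)\<^sup>2 - 2 * k * X1 + \<epsilon> / 4 * \<rho>\<^sup>2" .
    have "Re (q (z + \<eta>)) - Re (q z) - X2 - X3 = Re (q (z + \<eta>) - q z - \<eta> *\<^sub>C b' - \<eta>\<^sup>2 *\<^sub>C d')"
      by (simp only: scaleC_complex_def minus_complex.sel X2_def X3_def)
    also have "\<dots> \<le> \<epsilon> / 4 * \<rho>\<^sup>2"
      using near[OF \<eta>0] \<eta> by (intro order_trans[OF complex_Re_le_cmod]) blast
    finally have 3: "Re (q (z + \<eta>)) \<le> Re (q z) + X2 + X3 + \<epsilon> / 4 * \<rho>\<^sup>2" by simp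
    have "\<rho>\<^sup>2 = (Re \<eta>)\<^sup>2 + (Im \<eta>)\<^sup>2" using cmod_power2[of \<eta>] \<eta> by simp
    then have "(cmod (z + \<eta>))\<^sup>2 = (cmod z)\<^sup>2 + 2 * X4 + \<rho>\<^sup>2"
      by (simp only: cmod_power2 X4_def) (simp add: power2_eq_square algebra_simps)
    then have 4: "\<psi> (z + \<eta>) = Re (q (z + \<eta>)) + \<epsilon> * B\<^sup>2 - \<epsilon> * (cmod z)\<^sup>2 - 2 * \<epsilon> * X4 - \<epsilon> * \<rho>\<^sup>2"
      by (simp add: \<psi>_def algebra_simps)
    have 5: "\<psi> z = Re (q z) + \<epsilon> * B\<^sup>2 - \<epsilon> * (cmod z)\<^sup>2" by (simp add: \<psi>_def algebra_simps)
    have "F - \<psi> z - k * (norm y)\<^sup>2 + \<psi> (z + \<eta>) + k * (norm y')\<^sup>2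
       \<le> F - \<epsilon> / 2 * \<rho>\<^sup>2 + X2 - 2 * \<epsilon> * X4 + X3 - 2 * k * X1"
      using 2 3 unfolding 4 5 by simp
    also have "\<dots> = Re (of_real (F - \<epsilon> / 2 * \<rho>\<^sup>2) + (b' - of_real (2 * \<epsilon>) * cnj z) * \<eta>
        + (d' - of_real (2 * k) * \<kappa>) * \<eta>\<^sup>2)"
    proof -
      have *: "Re (of_real s * v) = s * Re v" for s v by simp
      have "of_real (F - \<epsilon> / 2 * \<rho>\<^sup>2) + (b' - of_real (2 * \<epsilon>) * cnj z) * \<eta> + (d' - of_real (2 * k) * \<kappa>) * \<eta>\<^sup>2
          = of_real (F - \<epsilon> / 2 * \<rho>\<^sup>2) + \<eta> * b' - of_real (2 * \<epsilon>) * (cnj z * \<eta>) + \<eta>\<^sup>2 * d' - of_real (2 * k) * (\<eta>\<^sup>2 * \<kappa>)"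
        by (simp add: algebra_simps)
      then show ?thesis
        by (simp only: plus_complex.sel minus_complex.sel * Re_complex_of_real X1_def X2_def X3_def X4_def)
    qed
    finally show "\<phi> (x + \<eta> *\<^sub>C b) \<le> ereal (Re (of_real (F - \<epsilon> / 2 * \<rho>\<^sup>2) + (b' - of_real (2 * \<epsilon>) * cnj z) * \<eta>
        + (d' - of_real (2 * k) * \<kappa>) * \<eta>\<^sup>2))"
      using 1 by (meson ereal_less_eq(3) order_trans)
  qed
  then have "\<epsilon> / 2 * \<rho>\<^sup>2 \<le> 0" by (simp add: x_def F)
  then show False using \<epsilon> \<rho> by (simp add: mult_le_0_iff)
qed

section \<open>Families of discs in a pseudoconvex set\<close>

text \<open>
  The exhaustion function \<open>u\<close> is bounded on the compact set swept out by the boundaries. By the maximum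
  principle the same bound holds on every disc that lies in \<open>S\<close>, so these discs lie in one compact
  subset of \<open>S\<close>. Hence lying in \<open>S\<close> is a closed condition on the parameter; it is also open.
\<close>

lemma disc_family_stays_inside:
  fixes S :: "'a::{complex_vector, euclidean_space} set"
  assumes pc: "pseudoconvex S" and K: "compact K"
    and cont: "continuous_on ({0..1} \<times> K) (\<lambda>p. F (fst p) (snd p))"
    and jet: "\<And>s z. s \<in> {0..1} \<Longrightarrow> z \<in> interior K \<Longrightarrow> \<exists>b d. has_jet2 (F s) z b d"
    and start: "F 0 ` K \<subseteq> S"
    and bdry: "\<And>s. s \<in> {0..1::real} \<Longrightarrow> F s ` frontier K \<subseteq> S"
    and s: "s \<in> {0..1}"
  shows "F s ` K \<subseteq> S"
proof -
  obtain u :: "'a \<Rightarrow> real" where S: "open S" and uc: "continuous_on S u"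
    and upsh: "plurisubharmonic_on S (\<lambda>x. ereal (u x))"
    and exh: "\<And>c. closure {x \<in> S. u x < c} \<subseteq> S"
    using pc unfolding pseudoconvex_def by blast
  define A where "A = {s \<in> {0..1}. F s ` K \<subseteq> S}"
  have sec: "continuous_on K (F s)" if "s \<in> {0..1}" for s
  proof -
    have "continuous_on K (\<lambda>z. (s, z))" "(\<lambda>z. (s, z)) ` K \<subseteq> {0..1} \<times> K"
      using that by (auto intro!: continuous_on_Pair continuous_on_const continuous_on_id)
    from continuous_on_compose2[OF cont this] show ?thesis by simp
  qed
  have sec': "continuous_on {0..1} (\<lambda>s. F s z)" if "z \<in> K" for z
  proof -
    have "continuous_on {0..1} (\<lambda>s. (s, z))" "(\<lambda>s. (s, z)) ` {0..1} \<subseteq> {0..1} \<times> K"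
      using that by (auto intro!: continuous_on_Pair continuous_on_const continuous_on_id)
    from continuous_on_compose2[OF cont this] show ?thesis by simp
  qed
  have frK: "frontier K \<subseteq> K" using compact_imp_closed[OF K] by (simp add: frontier_subset_closed)
  have "continuous_on ({0..1} \<times> frontier K) (\<lambda>p. F (fst p) (snd p))"
    by (rule continuous_on_subset[OF cont]) (use frK in auto)
  then have "compact ((\<lambda>p. F (fst p) (snd p)) ` ({0..1} \<times> frontier K))"
    by (intro compact_continuous_image compact_Times compact_Icc compact_frontier K)
  moreover have sub: "(\<lambda>p. F (fst p) (snd p)) ` ({0..1} \<times> frontier K) \<subseteq> S"
    using bdry by fastforce
  ultimately have "compact (u ` ((\<lambda>p. F (fst p) (snd p)) ` ({0..1} \<times> frontier K)))"
    using compact_continuous_image continuous_on_subset[OF uc] by blast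
  then have "bdd_above (u ` ((\<lambda>p. F (fst p) (snd p)) ` ({0..1} \<times> frontier K)))"
    by (intro bounded_imp_bdd_above compact_imp_bounded)
  then obtain C where C: "\<And>s z. s \<in> {0..1} \<Longrightarrow> z \<in> frontier K \<Longrightarrow> u (F s z) \<le> C"
    unfolding bdd_above_def by fastforce
  have in_A: "u (F s z) < C + 1" if "s \<in> A" "z \<in> K" for s z
  proof -
    have s: "s \<in> {0..1}" "F s ` K \<subseteq> S" using that by (auto simp: A_def)
    have "ereal (u (F s z)) \<le> ereal (Re (of_real C + z *\<^sub>C 0))"
      using disc_maximum_principle[OF upsh K sec[OF s(1)] s(2) jet[OF s(1)], of "\<lambda>z. of_real C + z *\<^sub>C 0" z]
        has_jet2_affine[of "of_real C" "0::complex"] C[OF s(1)] \<open>z \<in> K\<close>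
      by (auto intro!: continuous_intros simp: scaleC_complex_def)
    then show ?thesis by (simp add: scaleC_complex_def)
  qed
  define T where "T = closure {x \<in> S. u x < C + 1}"
  have A_eq: "A = {0..1} \<inter> (\<Inter>z\<in>K. {s \<in> {0..1}. F s z \<in> T})"
  proof
    show "A \<subseteq> {0..1} \<inter> (\<Inter>z\<in>K. {s \<in> {0..1}. F s z \<in> T})"
    proof
      fix s assume s: "s \<in> A"
      then have s': "s \<in> {0..1}" "F s ` K \<subseteq> S" by (auto simp: A_def)
      have "F s z \<in> T" if "z \<in> K" for z
        unfolding T_def using in_A[OF s that] s'(2) that by (intro closure_subset[THEN subsetD]) auto
      then show "s \<in> {0..1} \<inter> (\<Inter>z\<in>K. {s \<in> {0..1}. F s z \<in> T})" using s' by auto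
    qed
    have "T \<subseteq> S" unfolding T_def by (rule exh)
    then show "{0..1} \<inter> (\<Inter>z\<in>K. {s \<in> {0..1}. F s z \<in> T}) \<subseteq> A" by (auto simp: A_def)
  qed
  have "closed A"
    unfolding A_eq
  proof (intro closed_Int closed_INT ballI closed_atLeastAtMost)
    fix z assume "z \<in> K"
    have "closed ({0..1} \<inter> (\<lambda>s. F s z) -` T)"
      by (rule continuous_closed_preimage[OF sec'[OF \<open>z \<in> K\<close>]]) (auto simp: T_def)
    moreover have "{0..1} \<inter> (\<lambda>s. F s z) -` T = {s \<in> {0..1}. F s z \<in> T}" by auto
    ultimately show "closed {s \<in> {0..1}. F s z \<in> T}" by simp
  qed
  then have cl: "closedin (top_of_set {0..1}) A"
    by (rule closed_subset[rotated]) (auto simp: A_def)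
  have "closedin (top_of_set ({0..1} \<times> K)) (({0..1} \<times> K) \<inter> (\<lambda>p. F (fst p) (snd p)) -` (- S))"
    by (rule continuous_closedin_preimage[OF cont]) (use S in auto)
  then have "compact (({0..1} \<times> K) \<inter> (\<lambda>p. F (fst p) (snd p)) -` (- S))"
    by (rule closedin_compact[OF compact_Times[OF compact_Icc K]])
  then have "closed (fst ` (({0..1} \<times> K) \<inter> (\<lambda>p. F (fst p) (snd p)) -` (- S)))"
    by (intro compact_imp_closed compact_continuous_image continuous_intros)
  moreover have "A = {0..1} - fst ` (({0..1} \<times> K) \<inter> (\<lambda>p. F (fst p) (snd p)) -` (- S))"
    by (force simp: A_def)
  ultimately have op: "openin (top_of_set {0..1}) A"
    by (metis Diff_eq open_Compl openin_open_Int)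
  have "0 \<in> A" using start by (simp add: A_def)
  then have "A = {0..1}"
    using connected_Icc[of 0 "1::real"] cl op unfolding connected_clopen by blast
  then have "s \<in> A" using s by simp
  then show ?thesis unfolding A_def by blast
qed

section \<open>Logarithmic coordinates\<close>

definition vec_exp :: "complex ^ 'n \<Rightarrow> complex ^ 'n" where
  "vec_exp w = (\<chi> i. exp (w $ i))"

definition vec_of_real :: "real ^ 'n \<Rightarrow> complex ^ 'n" where
  "vec_of_real x = (\<chi> i. of_real (x $ i))"

definition vec_Re :: "complex ^ 'n \<Rightarrow> real ^ 'n" where
  "vec_Re w = (\<chi> i. Re (w $ i))"

text \<open>
  For a torus invariant set, this is the fiber over \<open>t\<close> in the coordinates \<open>x = log |z|\<close>. Points with a vanishing coordinate are not
  represented.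
\<close>

definition log_fiber :: "('a \<times> (complex ^ 'n)) set \<Rightarrow> 'a \<Rightarrow> (real ^ 'n) set" where
  "log_fiber \<Omega> t = {x. (t, vec_exp (vec_of_real x)) \<in> \<Omega>}"

definition torus_invariant :: "('a \<times> (complex ^ 'n::finite)) set \<Rightarrow> bool" where
  "torus_invariant \<Omega> \<longleftrightarrow> (\<forall>t z \<alpha>. (t, z) \<in> \<Omega> \<longrightarrow> \<alpha> \<in> torus \<longrightarrow> (t, torus_act \<alpha> z) \<in> \<Omega>)"

lemma vec_Re_of_real [simp]: "vec_Re (vec_of_real x) = x"
  by (simp add: vec_Re_def vec_of_real_def)

lemma continuous_on_vec_exp [continuous_intros]:
  fixes f :: "'a::topological_space \<Rightarrow> complex ^ 'n"
  assumes "continuous_on S f"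
  shows "continuous_on S (\<lambda>x. vec_exp (f x))"
  unfolding vec_exp_def by (intro continuous_intros assms)

lemma continuous_on_vec_of_real [continuous_intros]:
  fixes f :: "'a::topological_space \<Rightarrow> real ^ 'n"
  assumes "continuous_on S f"
  shows "continuous_on S (\<lambda>x. vec_of_real (f x))"
  unfolding vec_of_real_def by (intro continuous_intros assms)

lemma continuous_on_torus_act [continuous_intros]:
  fixes f g :: "'a::topological_space \<Rightarrow> complex ^ 'n::finite"
  assumes "continuous_on S f" "continuous_on S g"
  shows "continuous_on S (\<lambda>x. torus_act (f x) (g x))"
  unfolding torus_act_def by (intro continuous_intros assms)

lemma torus_eq: "torus = {\<alpha> :: complex ^ 'n::finite. \<forall>i. cmod (\<alpha> $ i) = 1}"
proof
  show "torus \<subseteq> {\<alpha> :: complex ^ 'n. \<forall>i. cmod (\<alpha> $ i) = 1}" by (auto simp: torus_def)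
  show "{\<alpha> :: complex ^ 'n. \<forall>i. cmod (\<alpha> $ i) = 1} \<subseteq> torus"
  proof
    fix \<alpha> :: "complex ^ 'n" assume "\<alpha> \<in> {\<alpha>. \<forall>i. cmod (\<alpha> $ i) = 1}"
    then have 1: "cmod (\<alpha> $ i) = 1" for i by simp
    have "cis (Arg (\<alpha> $ i)) = \<alpha> $ i" for i
    proof -
      have "\<alpha> $ i \<noteq> 0" using 1[of i] by auto
      then show ?thesis using 1[of i] by (simp add: cis_Arg sgn_div_norm)
    qed
    then have "\<alpha> = (\<chi> i. cis ((\<chi> i. Arg (\<alpha> $ i)) $ i))"
      by (simp add: vec_eq_iff)
    then show "\<alpha> \<in> torus" unfolding torus_def by blast
  qed
qed

lemma compact_torus: "compact (torus :: (complex ^ 'n::finite) set)"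
proof -
  have "norm \<alpha> \<le> real CARD('n)" if "\<alpha> \<in> torus" for \<alpha> :: "complex ^ 'n"
  proof -
    have "norm \<alpha> \<le> (\<Sum>i\<in>UNIV. cmod (\<alpha> $ i))" unfolding norm_vec_def by (rule L2_set_le_sum) simp
    then show ?thesis using that by (simp add: torus_eq)
  qed
  then have "bounded (torus :: (complex ^ 'n) set)" by (auto simp: bounded_iff)
  moreover have "closed (torus :: (complex ^ 'n) set)"
    unfolding torus_eq by (intro closed_Collect_all closed_Collect_eq continuous_intros)
  ultimately show ?thesis by (simp add: compact_eq_bounded_closed)
qed

lemma vec_exp_torus_act:
  fixes w w' :: "complex ^ 'n::finite"
  assumes "vec_Re w = vec_Re w'"
  obtains \<alpha> where "\<alpha> \<in> torus" "vec_exp w = torus_act \<alpha> (vec_exp w')"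
proof (rule that)
  show "(\<chi> i. cis (Im (w $ i) - Im (w' $ i))) \<in> torus" by (simp add: torus_eq)
  have "Re (w $ i) = Re (w' $ i)" for i using assms by (simp add: vec_Re_def vec_eq_iff)
  then show "vec_exp w = torus_act (\<chi> i. cis (Im (w $ i) - Im (w' $ i))) (vec_exp w')"
    by (simp add: vec_exp_def torus_act_def vec_eq_iff exp_eq_polar cis_mult mult.left_commute)
qed

lemma torus_invariant_vec_exp:
  assumes "torus_invariant \<Omega>"
  shows "(t, vec_exp w) \<in> \<Omega> \<longleftrightarrow> vec_Re w \<in> log_fiber \<Omega> t"
proof -
  have "(t, vec_exp w) \<in> \<Omega>" if "(t, vec_exp w') \<in> \<Omega>" "vec_Re w = vec_Re w'" for w w'
    using vec_exp_torus_act[OF that(2)] that(1) assms unfolding torus_invariant_def by metis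
  from this[of "vec_of_real (vec_Re w)" w] this[of w "vec_of_real (vec_Re w)"] show ?thesis
    unfolding log_fiber_def by auto
qed

lemma open_log_fiber:
  fixes \<Omega> :: "('a::topological_space \<times> (complex ^ 'n)) set"
  assumes "open \<Omega>"
  shows "open (log_fiber \<Omega> t)"
proof -
  have "open ((\<lambda>x::real ^ 'n. (t, vec_exp (vec_of_real x))) -` \<Omega>)"
    by (rule open_vimage[OF assms]) (intro continuous_intros)
  then show ?thesis by (simp add: log_fiber_def vimage_def)
qed

text \<open>
  The next three lemmas bound functions on vertical strips: the points \<open>exp w\<close> with \<open>Re w\<close> in a compact
  set fill a compact set, although the \<open>w\<close> do not.
\<close>

lemma compact_torus_orbit:
  fixes t :: "'a::topological_space" and X :: "(real ^ 'n::finite) set"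
  assumes "compact X"
  shows "compact ({t} \<times> (\<lambda>p. torus_act (fst p) (vec_exp (vec_of_real (snd p)))) ` (torus \<times> X))"
  by (intro compact_Times compact_continuous_image continuous_intros compact_torus assms)
    simp

lemma vec_exp_in_torus_orbit:
  fixes w :: "complex ^ 'n::finite"
  assumes "vec_Re w \<in> X"
  shows "vec_exp w \<in> (\<lambda>p. torus_act (fst p) (vec_exp (vec_of_real (snd p)))) ` (torus \<times> X)"
proof -
  obtain \<alpha> where "\<alpha> \<in> torus" "vec_exp w = torus_act \<alpha> (vec_exp (vec_of_real (vec_Re w)))"
    using vec_exp_torus_act[of w "vec_of_real (vec_Re w)"] by auto
  then show ?thesis using assms by force
qed

lemma psh_bounded_on_torus_orbit:
  fixes \<Omega> :: "((complex ^ 'r::finite) \<times> (complex ^ 'n::finite)) set"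
  assumes "plurisubharmonic_on \<Omega> \<phi>" "torus_invariant \<Omega>" "compact X" "X \<subseteq> log_fiber \<Omega> t"
  obtains M :: real where "\<And>w. vec_Re w \<in> X \<Longrightarrow> \<phi> (t, vec_exp w) \<le> ereal M"
proof -
  let ?P = "{t} \<times> (\<lambda>p. torus_act (fst p) (vec_exp (vec_of_real (snd p)))) ` (torus \<times> X)"
  have sub: "?P \<subseteq> \<Omega>"
    using assms(2,4) unfolding torus_invariant_def log_fiber_def by fastforce
  have usc: "upper_semicontinuous_on ?P \<phi>" and fin: "\<And>p. p \<in> ?P \<Longrightarrow> \<phi> p < \<infinity>"
    using assms(1) usc_subset[OF _ sub] sub unfolding plurisubharmonic_on_def by blast+
  obtain M where M: "0 \<le> M" "\<And>p. p \<in> ?P \<Longrightarrow> \<phi> p \<le> ereal M"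
    by (rule usc_bounded_above[OF compact_torus_orbit[OF assms(3)] usc fin]) blast+
  show ?thesis
  proof (rule that)
    fix w :: "complex ^ 'n" assume "vec_Re w \<in> X"
    then show "\<phi> (t, vec_exp w) \<le> ereal M"
      using M(2)[of "(t, vec_exp w)"] vec_exp_in_torus_orbit[of w X] by simp
  qed
qed

lemma scaleC_zero_right [simp]: "c *\<^sub>C 0 = (0::'a::complex_vector)"
  using scaleC_add_right[of c 0 "0::'a"] by simp

lemma exp_disc_has_jet2:
  fixes a b :: "complex ^ 'r" and g :: "'n::finite \<Rightarrow> complex \<Rightarrow> complex"
  assumes "\<And>i. g i holomorphic_on UNIV"
  shows "\<exists>b' d'. has_jet2 (\<lambda>\<zeta>. (a + \<zeta> *\<^sub>C b, vec_exp (\<chi> i. g i \<zeta>))) z b' d'"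
proof -
  have "\<exists>b d. has_jet2 (\<lambda>\<zeta>. exp (g i \<zeta>)) z b d" for i
    by (rule holomorphic_has_jet2[of _ UNIV]) (auto intro!: holomorphic_intros assms)
  then obtain B D where BD: "\<And>i. has_jet2 (\<lambda>\<zeta>. exp (g i \<zeta>)) z (B i) (D i)" by metis
  have "has_jet2 (\<lambda>\<zeta>. vec_exp (\<chi> i. g i \<zeta>)) z (\<chi> i. B i) (\<chi> i. D i)"
    by (rule has_jet2_vec) (simp add: vec_exp_def BD)
  from has_jet2_Pair[OF has_jet2_affine this] show ?thesis by blast
qed

text \<open>
  This is a three-lines argument. The segment is the real trace of the strip \<open>0 \<le> Re \<zeta> \<le> 1\<close>, on which
  \<open>\<phi>\<close> is bounded by some \<open>M\<close>. On a tall rectangle in the strip, \<open>C + \<delta> (1 - \<zeta>\<^sup>2)\<close> has real part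
  \<open>C + \<delta> (1 - (Re \<zeta>)\<^sup>2 + (Im \<zeta>)\<^sup>2)\<close>, which is at least \<open>C\<close> on the vertical sides and at least \<open>M\<close> on the
  horizontal ones. The maximum principle applies, and \<open>\<delta>\<close> tends to 0. The lemma is applied
  also to an exhaustion function, whose values vary on torus orbits; therefore the bounds at the ends
  range over whole orbits.
\<close>

lemma psh_le_on_log_segment:
  fixes \<Omega> :: "((complex ^ 'r::finite) \<times> (complex ^ 'n::finite)) set" and x y :: "real ^ 'n"
  assumes psh: "plurisubharmonic_on \<Omega> \<phi>" and inv: "torus_invariant \<Omega>"
    and seg: "closed_segment x y \<subseteq> log_fiber \<Omega> t"
    and bx: "\<And>w. vec_Re w = x \<Longrightarrow> \<phi> (t, vec_exp w) \<le> ereal C"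
    and by': "\<And>w. vec_Re w = y \<Longrightarrow> \<phi> (t, vec_exp w) \<le> ereal C"
    and v: "v \<in> closed_segment x y"
  shows "\<phi> (t, vec_exp (vec_of_real v)) \<le> ereal C"
proof -
  obtain M where M: "\<And>w. vec_Re w \<in> closed_segment x y \<Longrightarrow> \<phi> (t, vec_exp w) \<le> ereal M"
    by (rule psh_bounded_on_torus_orbit[OF psh inv compact_segment seg]) blast
  obtain \<sigma> where \<sigma>: "0 \<le> \<sigma>" "\<sigma> \<le> 1" "v = (1 - \<sigma>) *\<^sub>R x + \<sigma> *\<^sub>R y"
    using v by (auto simp: in_segment)
  define W where "W \<zeta> = (\<chi> i. of_real (x $ i) + \<zeta> * of_real (y $ i - x $ i))" for \<zeta> :: complex
  have ReW: "vec_Re (W \<zeta>) = (1 - Re \<zeta>) *\<^sub>R x + Re \<zeta> *\<^sub>R y" for \<zeta>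
    by (simp add: vec_Re_def W_def vec_eq_iff algebra_simps)
  have ReW_seg: "vec_Re (W \<zeta>) \<in> closed_segment x y" if "0 \<le> Re \<zeta>" "Re \<zeta> \<le> 1" for \<zeta>
    unfolding ReW in_segment using that by blast
  define f where "f \<zeta> = (t + \<zeta> *\<^sub>C 0, vec_exp (W \<zeta>))" for \<zeta>
  have fjet: "\<exists>b d. has_jet2 f z b d" for z
    unfolding f_def W_def by (rule exp_disc_has_jet2) (intro holomorphic_intros)
  have fc: "continuous_on A f" for A
    unfolding f_def W_def by (intro continuous_intros)
  have bound: "\<phi> (t, vec_exp (vec_of_real v)) \<le> ereal C + ereal \<delta>" if \<delta>: "0 < \<delta>" for \<delta>
  proof -
    define H where "H = 1 + (\<bar>M\<bar> + \<bar>C\<bar>) / \<delta>"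
    have H1: "1 \<le> H" using \<delta> by (simp add: H_def)
    have "\<bar>M\<bar> + \<bar>C\<bar> \<le> \<delta> * H" using \<delta> by (simp add: H_def field_simps)
    also have "\<dots> \<le> \<delta> * H\<^sup>2" using H1 \<delta> by (intro mult_left_mono) (auto simp: power2_eq_square)
    finally have H: "\<bar>M\<bar> + \<bar>C\<bar> \<le> \<delta> * H\<^sup>2" .
    define K where "K = cbox (Complex 0 (- H)) (Complex 1 H)"
    have K: "z \<in> K \<longleftrightarrow> 0 \<le> Re z \<and> Re z \<le> 1 \<and> - H \<le> Im z \<and> Im z \<le> H" for z
      unfolding K_def by (auto simp: in_cbox_complex_iff)
    have frK: "z \<in> K \<and> (Re z = 0 \<or> Re z = 1 \<or> Im z = - H \<or> Im z = H)" if "z \<in> frontier K" for z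
    proof -
      have "z \<in> K" "z \<notin> box (Complex 0 (- H)) (Complex 1 H)"
        using that by (auto simp: frontier_def K_def)
      then show ?thesis unfolding K in_box_complex_iff by auto
    qed
    define q where "q \<zeta> = of_real C + of_real \<delta> * (1 - \<zeta>\<^sup>2)" for \<zeta> :: complex
    have Req: "Re (q \<zeta>) = C + \<delta> * (1 - (Re \<zeta>)\<^sup>2 + (Im \<zeta>)\<^sup>2)" for \<zeta>
      by (simp add: q_def power2_eq_square)
    have "\<phi> (f (of_real \<sigma>)) \<le> ereal (Re (q (of_real \<sigma>)))"
    proof (rule disc_maximum_principle[OF psh, where f = f and q = q and K = K])
      show "compact K" by (simp add: K_def)
      show "continuous_on K f" by (rule fc)
      show "f ` K \<subseteq> \<Omega>"
      proof
        fix p assume "p \<in> f ` K"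
        then obtain z where "z \<in> K" "p = f z" by blast
        then show "p \<in> \<Omega>" using ReW_seg[of z] seg torus_invariant_vec_exp[OF inv, of t "W z"]
          by (auto simp: f_def K)
      qed
      show "\<exists>b d. has_jet2 f z b d" if "z \<in> interior K" for z by (rule fjet)
      show "continuous_on K q" unfolding q_def by (intro continuous_intros)
      show "\<exists>b d. has_jet2 q z b d" if "z \<in> interior K" for z
        unfolding q_def by (rule holomorphic_has_jet2[of _ UNIV]) (auto intro!: holomorphic_intros)
      show "of_real \<sigma> \<in> K" using \<sigma> H1 by (simp add: K)
      fix z assume "z \<in> frontier K"
      from frK[OF this] have zK: "z \<in> K" and cases: "Re z = 0 \<or> Re z = 1 \<or> \<bar>Im z\<bar> = H"
        using H1 by auto
      have rz: "0 \<le> Re z" "Re z \<le> 1" using zK by (auto simp: K)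
      have sq: "(Re z)\<^sup>2 \<le> 1" using rz by (simp add: power_le_one)
      from cases consider (x) "Re z = 0" | (y) "Re z = 1" | (H) "\<bar>Im z\<bar> = H" by blast
      then show "\<phi> (f z) \<le> ereal (Re (q z))"
      proof cases
        case x
        have "\<phi> (f z) \<le> ereal C" unfolding f_def using bx[of "W z"] x by (simp add: ReW)
        also have "C \<le> Re (q z)" using \<delta> sq by (simp add: Req)
        finally show ?thesis by simp
      next
        case y
        have "\<phi> (f z) \<le> ereal C" unfolding f_def using by'[of "W z"] y by (simp add: ReW)
        also have "C \<le> Re (q z)" using \<delta> sq by (simp add: Req)
        finally show ?thesis by simp
      next
        case H': H
        have "\<phi> (f z) \<le> ereal M" unfolding f_def using M[OF ReW_seg[OF rz]] by simp
        also have "M \<le> C + \<delta> * H\<^sup>2" using H by linarith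
        also have "\<dots> \<le> Re (q z)"
        proof -
          have "(Im z)\<^sup>2 = H\<^sup>2" using H' by (metis power2_abs)
          then show ?thesis using \<delta> sq by (simp add: Req algebra_simps)
        qed
        finally show ?thesis by simp
      qed
    qed
    moreover have "f (of_real \<sigma>) = (t, vec_exp (vec_of_real v))"
    proof -
      have "W (of_real \<sigma>) $ i = vec_of_real v $ i" for i
        by (simp add: W_def vec_of_real_def \<sigma>(3) algebra_simps)
      then have "W (of_real \<sigma>) = vec_of_real v" unfolding vec_eq_iff by blast
      then show ?thesis by (simp add: f_def)
    qed
    ultimately have 1: "\<phi> (t, vec_exp (vec_of_real v)) \<le> ereal (Re (q (of_real \<sigma>)))"
      by (simp only:)
    have "\<delta> * (1 - \<sigma>\<^sup>2) \<le> \<delta> * 1" using \<delta> by (intro mult_left_mono) auto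
    then have 2: "Re (q (of_real \<sigma>)) \<le> C + \<delta>" unfolding Req by simp
    have "ereal (Re (q (of_real \<sigma>))) \<le> ereal C + ereal \<delta>" using 2 by simp
    with 1 show ?thesis by (rule order_trans)
  qed
  show ?thesis by (rule ereal_le_epsilon2) (rule bound)
qed

lemma torus_act_norm:
  fixes z :: "complex ^ 'n::finite"
  obtains \<alpha> where "\<alpha> \<in> torus" "torus_act \<alpha> z = (\<chi> i. of_real (cmod (z $ i)))"
proof (rule that)
  define \<alpha> where "\<alpha> = (\<chi> i. if z $ i = 0 then 1 else cnj (z $ i) / of_real (cmod (z $ i)))"
  show "\<alpha> \<in> torus" by (simp add: torus_eq \<alpha>_def norm_divide)
  have "\<alpha> $ i * z $ i = of_real (cmod (z $ i))" for i
  proof (cases "z $ i = 0")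
    case False
    have "cnj (z $ i) * z $ i = of_real (cmod (z $ i)) * of_real (cmod (z $ i))"
      by (simp add: complex_norm_square[symmetric] mult.commute power2_eq_square[symmetric])
    then show ?thesis using False by (simp add: \<alpha>_def)
  qed (simp add: \<alpha>_def)
  then show "torus_act \<alpha> z = (\<chi> i. of_real (cmod (z $ i)))"
    by (simp add: torus_act_def)
qed

lemma vec_norm_le_card:
  fixes z :: "'a::real_normed_vector ^ 'n::finite"
  assumes "\<And>i. norm (z $ i) \<le> e"
  shows "norm z \<le> real CARD('n) * e"
proof -
  have "norm z \<le> (\<Sum>i\<in>UNIV. norm (z $ i))" unfolding norm_vec_def by (rule L2_set_le_sum) simp
  also have "\<dots> \<le> (\<Sum>i\<in>(UNIV::'n set). e)" by (intro sum_mono assms)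
  finally show ?thesis by simp
qed

section \<open>Convexity of the logarithmic fibers\<close>

text \<open>
  Removing the coordinate hyperplanes might disconnect the fiber. It does not: given a path in the
  fiber, replace every coordinate by its absolute value plus a small positive constant. By compactness
  of the path the result stays in the fiber, and now it avoids the hyperplanes.
\<close>

lemma connected_log_fiber:
  fixes \<Omega> :: "('a::topological_space \<times> (complex ^ 'n::finite)) set"
  assumes "open \<Omega>" and inv: "torus_invariant \<Omega>" and conn: "connected (fiber \<Omega> t)"
  shows "connected (log_fiber \<Omega> t)"
proof -
  define D where "D = fiber \<Omega> t"
  have D: "open D"
  proof -
    have "open ((\<lambda>z. (t, z)) -` \<Omega>)" by (rule open_vimage[OF assms(1)]) (intro continuous_intros)
    then show ?thesis by (simp add: D_def fiber_def vimage_def)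
  qed
  have L: "x \<in> log_fiber \<Omega> t \<longleftrightarrow> vec_exp (vec_of_real x) \<in> D" for x
    by (simp add: log_fiber_def D_def fiber_def)
  define av :: "complex ^ 'n \<Rightarrow> complex ^ 'n" where "av z = (\<chi> i. of_real (cmod (z $ i)))" for z
  have av: "av z \<in> D" if "z \<in> D" for z
  proof -
    obtain \<alpha> where "\<alpha> \<in> torus" "torus_act \<alpha> z = av z" unfolding av_def by (rule torus_act_norm)
    then show ?thesis using that inv unfolding D_def fiber_def torus_invariant_def by (metis mem_Collect_eq)
  qed
  define lg :: "real \<Rightarrow> complex ^ 'n \<Rightarrow> real ^ 'n" where "lg \<sigma> z = (\<chi> i. ln (cmod (z $ i) + \<sigma>))" for \<sigma> z
  have lg0: "lg 0 (vec_exp (vec_of_real x)) = x" for x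
    by (simp add: lg_def vec_exp_def vec_of_real_def vec_eq_iff)
  have "connected_component (log_fiber \<Omega> t) a b" if ab: "a \<in> log_fiber \<Omega> t" "b \<in> log_fiber \<Omega> t" for a b
  proof -
    define za where "za = vec_exp (vec_of_real a)"
    define zb where "zb = vec_exp (vec_of_real b)"
    have "za \<in> D" "zb \<in> D" using ab by (auto simp: L za_def zb_def)
    moreover have "path_connected D" using D conn connected_open_path_connected unfolding D_def by blast
    ultimately obtain \<gamma> where \<gamma>: "path \<gamma>" "path_image \<gamma> \<subseteq> D" "pathstart \<gamma> = za" "pathfinish \<gamma> = zb"
      unfolding path_connected_def by blast
    have "compact (av ` path_image \<gamma>)"
      unfolding av_def by (intro compact_continuous_image compact_path_image \<gamma>(1) continuous_intros)
    moreover have "av ` path_image \<gamma> \<subseteq> D" using av \<gamma>(2) by blast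
    ultimately obtain \<delta> where \<delta>: "0 < \<delta>" "(\<Union>x\<in>av ` path_image \<gamma>. cball x \<delta>) \<subseteq> D"
      using compact_subset_open_imp_cball_epsilon_subset[OF _ D] by blast
    define \<eta> where "\<eta> = \<delta> / real CARD('n)"
    have \<eta>: "0 < \<eta>" using \<delta> by (simp add: \<eta>_def)
    have inL: "lg \<sigma> z \<in> log_fiber \<Omega> t"
      if "z \<in> path_image \<gamma>" "0 \<le> \<sigma>" "\<sigma> \<le> \<eta>" "\<And>i. 0 < cmod (z $ i) + \<sigma>" for \<sigma> z
    proof -
      have eq: "vec_exp (vec_of_real (lg \<sigma> z)) = (\<chi> i. of_real (cmod (z $ i) + \<sigma>))"
      proof -
        have "exp (complex_of_real (ln (cmod (z $ i) + \<sigma>))) = of_real (cmod (z $ i) + \<sigma>)" for i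
          by (simp only: exp_of_real exp_ln[OF that(4)])
        then show ?thesis by (simp add: vec_exp_def vec_of_real_def lg_def)
      qed
      have "norm (av z - (\<chi> i. of_real (cmod (z $ i) + \<sigma>))) \<le> real CARD('n) * \<sigma>"
        by (rule vec_norm_le_card) (use that(2) in \<open>simp add: av_def\<close>)
      also have "\<dots> \<le> real CARD('n) * \<eta>" using that(3) by (intro mult_left_mono) auto
      also have "\<dots> = \<delta>" by (simp add: \<eta>_def)
      finally have "(\<chi> i. of_real (cmod (z $ i) + \<sigma>)) \<in> cball (av z) \<delta>" by (simp add: dist_norm)
      then show ?thesis unfolding L eq using \<delta>(2) that(1) by blast
    qed
    have za: "za \<in> path_image \<gamma>" and zb: "zb \<in> path_image \<gamma>" using \<gamma> by (metis pathstart_in_path_image, metis pathfinish_in_path_image)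
    have cc: "connected_component (log_fiber \<Omega> t) x (lg \<eta> (vec_exp (vec_of_real x)))"
      if "vec_exp (vec_of_real x) \<in> path_image \<gamma>" for x
    proof -
      have pos: "0 < cmod (vec_exp (vec_of_real x) $ i) + \<sigma>" if "0 \<le> \<sigma>" for i \<sigma>
        using that by (simp add: vec_exp_def add_pos_nonneg)
      have "connected ((\<lambda>\<sigma>. lg \<sigma> (vec_exp (vec_of_real x))) ` {0..\<eta>})"
        unfolding lg_def
        by (intro connected_continuous_image continuous_intros connected_Icc ballI)
          (metis atLeastAtMost_iff less_irrefl pos)
      moreover have "(\<lambda>\<sigma>. lg \<sigma> (vec_exp (vec_of_real x))) ` {0..\<eta>} \<subseteq> log_fiber \<Omega> t"
        using inL[OF that] pos by auto
      moreover have "x \<in> (\<lambda>\<sigma>. lg \<sigma> (vec_exp (vec_of_real x))) ` {0..\<eta>}"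
        using lg0[of x] \<eta> by (intro image_eqI[of _ _ 0]) auto
      moreover have "lg \<eta> (vec_exp (vec_of_real x)) \<in> (\<lambda>\<sigma>. lg \<sigma> (vec_exp (vec_of_real x))) ` {0..\<eta>}"
        using \<eta> by (intro image_eqI[of _ _ \<eta>]) auto
      ultimately show ?thesis unfolding connected_component_def by blast
    qed
    have "connected_component (log_fiber \<Omega> t) (lg \<eta> za) (lg \<eta> zb)"
    proof -
      have pos: "0 < cmod (z $ i) + \<eta>" for z :: "complex ^ 'n" and i using \<eta> by (simp add: add_nonneg_pos)
      have "connected (lg \<eta> ` path_image \<gamma>)"
        unfolding lg_def
        by (intro connected_continuous_image continuous_intros connected_path_image \<gamma>(1) ballI)
          (metis less_irrefl pos)
      moreover have "lg \<eta> ` path_image \<gamma> \<subseteq> log_fiber \<Omega> t" using inL \<eta> pos by auto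
      ultimately show ?thesis using za zb unfolding connected_component_def by blast
    qed
    then show ?thesis
      using cc[of a] cc[of b] za zb unfolding za_def zb_def
      by (meson connected_component_sym connected_component_trans)
  qed
  then show ?thesis by (simp add: connected_iff_connected_component)
qed

text \<open>
  Bochner's tube theorem. For fixed \<open>x\<close>, the set of those \<open>y\<close> whose segment to \<open>x\<close> lies in the
  logarithmic fiber is open. It is relatively closed, because the exhaustion function is bounded on
  such a segment by its values over the end points (\<open>psh_le_on_log_segment\<close>), so that limits of
  such segments stay in a compact subset of \<open>\<Omega>\<close>. Connectedness concludes.
\<close>

lemma convex_log_fiber:
  fixes \<Omega> :: "((complex ^ 'r::finite) \<times> (complex ^ 'n::finite)) set"
  assumes pc: "pseudoconvex \<Omega>" and inv: "torus_invariant \<Omega>" and conn: "connected (fiber \<Omega> t)"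
  shows "convex (log_fiber \<Omega> t)"
proof -
  define L where "L = log_fiber \<Omega> t"
  obtain u :: "(complex ^ 'r) \<times> (complex ^ 'n) \<Rightarrow> real" where \<Omega>: "open \<Omega>"
    and upsh: "plurisubharmonic_on \<Omega> (\<lambda>x. ereal (u x))"
    and exh: "\<And>c. closure {x \<in> \<Omega>. u x < c} \<subseteq> \<Omega>"
    using pc unfolding pseudoconvex_def by blast
  have L: "open L" unfolding L_def by (rule open_log_fiber[OF \<Omega>])
  have Lc: "connected L" unfolding L_def by (rule connected_log_fiber[OF \<Omega> inv conn])
  have "closed_segment x y \<subseteq> L" if x: "x \<in> L" and y: "y \<in> L" for x y
  proof -
    define E where "E = {y \<in> L. closed_segment x y \<subseteq> L}"
    define g where "g s y = (1 - s) *\<^sub>R x + s *\<^sub>R y" for s and y :: "real ^ 'n"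
    have seg: "closed_segment x y = (\<lambda>s. g s y) ` {0..1}" for y
      unfolding closed_segment_image_interval g_def ..
    have "openin (top_of_set L) E"
    proof (rule open_subset)
      show "open E"
        unfolding open_dist
      proof
        fix y assume y: "y \<in> E"
        then obtain \<epsilon> where \<epsilon>: "0 < \<epsilon>" "(\<Union>v\<in>closed_segment x y. ball v \<epsilon>) \<subseteq> L"
          using compact_subset_open_imp_ball_epsilon_subset[OF compact_segment L, of x y] unfolding E_def by blast
        have "y' \<in> E" if d: "dist y' y < \<epsilon>" for y'
        proof -
          have "g s y' \<in> L" if s: "s \<in> {0..1}" for s
          proof -
            have "dist (g s y) (g s y') = s * dist y y'"
              using s by (simp add: g_def dist_norm flip: scaleR_diff_right)
            also have "\<dots> \<le> 1 * dist y y'" using s by (intro mult_right_mono) auto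
            also have "\<dots> < \<epsilon>" using d by (simp add: dist_commute)
            finally have "g s y' \<in> ball (g s y) \<epsilon>" by simp
            moreover have "g s y \<in> closed_segment x y" using s seg by blast
            ultimately show ?thesis using \<epsilon>(2) by blast
          qed
          then have "closed_segment x y' \<subseteq> L" unfolding seg by blast
          then show ?thesis unfolding E_def by auto
        qed
        then show "\<exists>e>0. \<forall>y'. dist y' y < e \<longrightarrow> y' \<in> E" using \<epsilon>(1) by blast
      qed
    qed (auto simp: E_def)
    moreover have "closedin (top_of_set L) E"
    proof -
      have "y \<in> E" if yL: "y \<in> L" and ycl: "y \<in> closure E" for y
      proof -
        obtain r where r: "0 < r" "cball y r \<subseteq> L" using L yL open_contains_cball by blast
        have X: "compact (insert x (cball y r))" "insert x (cball y r) \<subseteq> log_fiber \<Omega> t"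
          using r(2) x by (auto simp: L_def)
        obtain C where C: "\<And>w. vec_Re w \<in> insert x (cball y r) \<Longrightarrow> ereal (u (t, vec_exp w)) \<le> ereal C"
          by (rule psh_bounded_on_torus_orbit[OF upsh inv X]) blast
        have ycl': "y \<in> closure (E \<inter> ball y r)"
          using ycl r(1) open_Int_closure_subset[OF open_ball, of y r E] by (auto simp: Int_commute)
        have "g s y \<in> L" if s: "s \<in> {0..1}" for s
        proof -
          define G where "G y = (t, vec_exp (vec_of_real (g s y)))" for y
          have sub: "G ` (E \<inter> ball y r) \<subseteq> {x \<in> \<Omega>. u x < C + 1}"
          proof
            fix p assume "p \<in> G ` (E \<inter> ball y r)"
            then obtain y' where y': "y' \<in> E" "y' \<in> ball y r" "p = G y'" by blast
            have sg: "closed_segment x y' \<subseteq> log_fiber \<Omega> t" using y'(1) by (auto simp: E_def L_def)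
            have gs: "g s y' \<in> closed_segment x y'" using s seg by blast
            have "ereal (u (t, vec_exp (vec_of_real (g s y')))) \<le> ereal C"
              by (rule psh_le_on_log_segment[OF upsh inv sg _ _ gs]) (use C y'(2) in auto)
            moreover have "p \<in> \<Omega>" using sg gs unfolding y'(3) G_def log_fiber_def by blast
            ultimately show "p \<in> {x \<in> \<Omega>. u x < C + 1}" by (simp add: y'(3) G_def)
          qed
          have "continuous_on A G" for A
            unfolding G_def g_def by (intro continuous_intros)
          then have "G ` closure (E \<inter> ball y r) \<subseteq> closure {x \<in> \<Omega>. u x < C + 1}"
            by (rule image_closure_subset[OF _ closed_closure]) (use sub closure_subset in blast)
          then have "G y \<in> \<Omega>" using ycl' exh by blast
          then show ?thesis by (simp add: G_def L_def log_fiber_def)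
        qed
        then have "closed_segment x y \<subseteq> L" unfolding seg by blast
        then show ?thesis using yL by (simp add: E_def)
      qed
      then have "E = L \<inter> closure E" using closure_subset[of E] by (auto simp: E_def)
      then show ?thesis by (metis closedin_closed_Int closed_closure)
    qed
    moreover have "x \<in> E" using x by (simp add: E_def)
    ultimately have "E = L" using Lc unfolding connected_clopen by blast
    then show ?thesis using y by (auto simp: E_def)
  qed
  then show ?thesis unfolding convex_contains_segment L_def by blast
qed

section \<open>The minimum principle over small discs\<close>

text \<open>
  Points chosen locally constantly are averaged with a partition of unity made of the functions
  \<open>max 0 (r - dist)\<close>; the averages stay in the slices by convexity.
\<close>

lemma continuous_selection_convex:
  fixes G :: "('a::metric_space \<times> 'b::real_normed_vector) set"
  assumes S: "compact S" and G: "open G"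
    and ne: "\<And>\<zeta>. \<zeta> \<in> S \<Longrightarrow> \<exists>x. (\<zeta>, x) \<in> G"
    and conv: "\<And>\<zeta>. \<zeta> \<in> S \<Longrightarrow> convex {x. (\<zeta>, x) \<in> G}"
  shows "\<exists>X. continuous_on S X \<and> (\<forall>\<zeta>\<in>S. (\<zeta>, X \<zeta>) \<in> G)"
proof -
  obtain x where x: "\<And>\<zeta>. \<zeta> \<in> S \<Longrightarrow> (\<zeta>, x \<zeta>) \<in> G" using ne by metis
  have "\<exists>r>0. \<forall>\<zeta>'. dist \<zeta>' \<zeta> < r \<longrightarrow> (\<zeta>', x \<zeta>) \<in> G" if "\<zeta> \<in> S" for \<zeta>
  proof -
    have "open ((\<lambda>\<zeta>'. (\<zeta>', x \<zeta>)) -` G)" by (rule open_vimage[OF G]) (intro continuous_intros)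
    then show ?thesis using x[OF that] unfolding open_dist by auto
  qed
  then obtain r where r: "\<And>\<zeta>. \<zeta> \<in> S \<Longrightarrow> 0 < r \<zeta>"
    "\<And>\<zeta> \<zeta>'. \<zeta> \<in> S \<Longrightarrow> dist \<zeta>' \<zeta> < r \<zeta> \<Longrightarrow> (\<zeta>', x \<zeta>) \<in> G" by metis
  have "S \<subseteq> (\<Union>\<zeta>\<in>S. ball \<zeta> (r \<zeta>))" using r(1) by force
  then obtain D where D: "D \<subseteq> S" "finite D" "S \<subseteq> (\<Union>\<zeta>\<in>D. ball \<zeta> (r \<zeta>))"
    using compactE_image[OF S, of S "\<lambda>\<zeta>. ball \<zeta> (r \<zeta>)"] by (metis open_ball)
  define h where "h d \<zeta> = max 0 (r d - dist \<zeta> d)" for d \<zeta>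
  define H where "H \<zeta> = (\<Sum>d\<in>D. h d \<zeta>)" for \<zeta>
  have h0: "0 \<le> h d \<zeta>" for d \<zeta> by (simp add: h_def)
  have Hpos: "0 < H \<zeta>" if "\<zeta> \<in> S" for \<zeta>
  proof -
    from subsetD[OF D(3) that] obtain d where "d \<in> D" "dist d \<zeta> < r d" by auto
    then show ?thesis unfolding H_def
      by (intro sum_pos2[of D d]) (auto simp: D(2) h0 h_def dist_commute)
  qed
  define X where "X \<zeta> = (\<Sum>d\<in>D. (h d \<zeta> / H \<zeta>) *\<^sub>R x d)" for \<zeta>
  have hc: "continuous_on S (h d)" for d unfolding h_def by (intro continuous_intros)
  have Hc: "continuous_on S H" unfolding H_def by (intro continuous_on_sum hc)
  have "H \<zeta> \<noteq> 0" if "\<zeta> \<in> S" for \<zeta> using Hpos[OF that] by simp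
  then have "continuous_on S X"
    unfolding X_def
    by (intro continuous_on_sum continuous_on_scaleR continuous_on_divide hc Hc continuous_on_const ballI)
  moreover have "(\<zeta>, X \<zeta>) \<in> G" if \<zeta>: "\<zeta> \<in> S" for \<zeta>
  proof -
    define D' where "D' = {d \<in> D. dist \<zeta> d < r d}"
    have D': "finite D'" "D' \<subseteq> D" using D(2) by (auto simp: D'_def)
    have zero: "h d \<zeta> = 0" if "d \<in> D - D'" for d using that by (auto simp: D'_def h_def)
    have "(\<Sum>d\<in>D'. h d \<zeta> / H \<zeta>) = (\<Sum>d\<in>D. h d \<zeta> / H \<zeta>)"
      by (rule sum.mono_neutral_left) (use D D' zero in auto)
    also have "\<dots> = 1" using Hpos[OF \<zeta>] by (simp add: H_def flip: sum_divide_distrib)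
    finally have one: "(\<Sum>d\<in>D'. h d \<zeta> / H \<zeta>) = 1" .
    have X: "X \<zeta> = (\<Sum>d\<in>D'. (h d \<zeta> / H \<zeta>) *\<^sub>R x d)"
      unfolding X_def by (rule sum.mono_neutral_right) (use D D' zero in auto)
    have "(\<Sum>d\<in>D'. (h d \<zeta> / H \<zeta>) *\<^sub>R x d) \<in> {x. (\<zeta>, x) \<in> G}"
    proof (rule convex_sum[OF D'(1) conv[OF \<zeta>] one])
      fix d assume d: "d \<in> D'"
      show "0 \<le> h d \<zeta> / H \<zeta>" using h0 Hpos[OF \<zeta>] by (simp add: less_imp_le)
      show "x d \<in> {x. (\<zeta>, x) \<in> G}" using d D(1) r(2)[of d \<zeta>] by (auto simp: D'_def)
    qed
    then show ?thesis by (simp add: X)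
  qed
  ultimately show ?thesis by blast
qed

definition torus_invariant_fun :: "('a \<times> (complex ^ 'n::finite)) set \<Rightarrow> ('a \<times> (complex ^ 'n) \<Rightarrow> ereal) \<Rightarrow> bool" where
  "torus_invariant_fun \<Omega> \<phi> \<longleftrightarrow>
     (\<forall>t z \<alpha>. (t, z) \<in> \<Omega> \<longrightarrow> \<alpha> \<in> torus \<longrightarrow> \<phi> (t, torus_act \<alpha> z) = \<phi> (t, z))"

lemma torus_invariant_fun_vec_exp:
  assumes "torus_invariant \<Omega>" "torus_invariant_fun \<Omega> \<phi>" "vec_Re w \<in> log_fiber \<Omega> t"
  shows "\<phi> (t, vec_exp w) = \<phi> (t, vec_exp (vec_of_real (vec_Re w)))"
proof -
  obtain \<alpha> where "\<alpha> \<in> torus" "vec_exp w = torus_act \<alpha> (vec_exp (vec_of_real (vec_Re w)))"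
    using vec_exp_torus_act[of w "vec_of_real (vec_Re w)"] by auto
  then show ?thesis using assms(2,3) unfolding torus_invariant_fun_def log_fiber_def by auto
qed

lemma convex_log_sublevel:
  fixes \<Omega> :: "((complex ^ 'r::finite) \<times> (complex ^ 'n::finite)) set"
  assumes pc: "pseudoconvex \<Omega>" and inv: "torus_invariant \<Omega>" and conn: "connected (fiber \<Omega> t)"
    and psh: "plurisubharmonic_on \<Omega> \<phi>" and \<phi>inv: "torus_invariant_fun \<Omega> \<phi>"
  shows "convex {x \<in> log_fiber \<Omega> t. \<phi> (t, vec_exp (vec_of_real x)) < ereal c}"
  unfolding convex_contains_segment
proof (intro ballI subsetI)
  fix x y v
  assume x: "x \<in> {x \<in> log_fiber \<Omega> t. \<phi> (t, vec_exp (vec_of_real x)) < ereal c}"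
    and y: "y \<in> {x \<in> log_fiber \<Omega> t. \<phi> (t, vec_exp (vec_of_real x)) < ereal c}"
    and v: "v \<in> closed_segment x y"
  have seg: "closed_segment x y \<subseteq> log_fiber \<Omega> t"
    using convex_log_fiber[OF pc inv conn] x y unfolding convex_contains_segment by blast
  have "max (\<phi> (t, vec_exp (vec_of_real x))) (\<phi> (t, vec_exp (vec_of_real y))) < ereal c"
    using x y by simp
  then obtain C where C: "max (\<phi> (t, vec_exp (vec_of_real x))) (\<phi> (t, vec_exp (vec_of_real y))) < ereal C"
    "ereal C < ereal c" using ereal_dense2 by blast
  have "\<phi> (t, vec_exp (vec_of_real v)) \<le> ereal C"
  proof (rule psh_le_on_log_segment[OF psh inv seg _ _ v])
    fix w assume "vec_Re w = x"
    then show "\<phi> (t, vec_exp w) \<le> ereal C"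
      using torus_invariant_fun_vec_exp[OF inv \<phi>inv, of w t] x C(1) by (simp add: less_imp_le)
  next
    fix w assume "vec_Re w = y"
    then show "\<phi> (t, vec_exp w) \<le> ereal C"
      using torus_invariant_fun_vec_exp[OF inv \<phi>inv, of w t] y C(1) by (simp add: less_imp_le)
  qed
  also note C(2)
  finally show "v \<in> {x \<in> log_fiber \<Omega> t. \<phi> (t, vec_exp (vec_of_real x)) < ereal c}"
    using v seg by blast
qed

lemma open_strict_log_sublevel:
  fixes \<Omega> :: "((complex ^ 'r::finite) \<times> (complex ^ 'n::finite)) set"
  assumes psh: "plurisubharmonic_on \<Omega> \<phi>" and h: "continuous_on UNIV h"
  shows "open {p. snd p \<in> log_fiber \<Omega> (a + fst p *\<^sub>C b) \<and>
      \<phi> (a + fst p *\<^sub>C b, vec_exp (vec_of_real (snd p))) < ereal (h (fst p))}" (is "open ?G")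
proof -
  define g where "g p = (a + fst p *\<^sub>C b, vec_exp (vec_of_real (snd p)))" for p :: "complex \<times> (real ^ 'n)"
  have gc: "continuous_on A g" for A unfolding g_def by (intro continuous_intros)
  have \<Omega>: "open \<Omega>" and usc: "upper_semicontinuous_on \<Omega> \<phi>"
    using psh unfolding plurisubharmonic_on_def by blast+
  have op: "open (g -` \<Omega>)" by (rule open_vimage[OF \<Omega> gc])
  have hc: "continuous_on (g -` \<Omega>) (\<lambda>p. - h (fst p))"
    by (intro continuous_on_minus continuous_on_compose2[OF h] continuous_on_fst continuous_on_id) auto
  have "upper_semicontinuous_on (g -` \<Omega>) (\<lambda>p. \<phi> (g p) + ereal (- h (fst p)))"
    by (intro usc_add_continuous usc_compose[OF usc gc] hc) auto
  then have "openin (top_of_set (g -` \<Omega>)) {p \<in> g -` \<Omega>. \<phi> (g p) + ereal (- h (fst p)) < 0}"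
    unfolding upper_semicontinuous_on_def by blast
  then have "open {p \<in> g -` \<Omega>. \<phi> (g p) + ereal (- h (fst p)) < 0}"
    using op openin_open_eq by blast
  moreover have "\<phi> (g p) + ereal (- h (fst p)) < 0 \<longleftrightarrow> \<phi> (g p) < ereal (h (fst p))" for p
    by (cases "\<phi> (g p)") auto
  ultimately show ?thesis by (simp add: g_def log_fiber_def)
qed

text \<open>
  Smallness of the disc enters only through the point \<open>x0\<close> common to all logarithmic fibers over it,
  which is the starting point of the deformation in the continuity principle.
\<close>

lemma minimum_principle_small_disc:
  fixes \<Omega> :: "((complex ^ 'r::finite) \<times> (complex ^ 'n::finite)) set"
  assumes pc: "pseudoconvex \<Omega>" and inv: "torus_invariant \<Omega>"
    and conn: "\<And>t. t \<in> fst ` \<Omega> \<Longrightarrow> connected (fiber \<Omega> t)"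
    and psh: "plurisubharmonic_on \<Omega> \<phi>" and \<phi>inv: "torus_invariant_fun \<Omega> \<phi>"
    and \<rho>: "0 < \<rho>" and x0: "\<And>\<zeta>. \<zeta> \<in> cball c \<rho> \<Longrightarrow> x0 \<in> log_fiber \<Omega> (a + \<zeta> *\<^sub>C b)"
    and lt: "\<And>\<zeta>. \<zeta> \<in> sphere c \<rho> \<Longrightarrow> \<exists>x\<in>log_fiber \<Omega> (a + \<zeta> *\<^sub>C b).
        \<phi> (a + \<zeta> *\<^sub>C b, vec_exp (vec_of_real x)) < ereal (Re (poly p (\<zeta> - c)))"
  shows "\<exists>z\<in>fiber \<Omega> (a + c *\<^sub>C b). \<phi> (a + c *\<^sub>C b, z) \<le> ereal (Re (poly p 0))"
proof -
  define T where "T \<zeta> = a + \<zeta> *\<^sub>C b" for \<zeta>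
  define G where "G = {p'. snd p' \<in> log_fiber \<Omega> (a + fst p' *\<^sub>C b) \<and>
      \<phi> (a + fst p' *\<^sub>C b, vec_exp (vec_of_real (snd p'))) < ereal (Re (poly p (fst p' - c)))}"
  have G: "open G" unfolding G_def
    by (rule open_strict_log_sublevel[OF psh]) (intro continuous_intros)
  have memG: "(\<zeta>, x) \<in> G \<longleftrightarrow> x \<in> log_fiber \<Omega> (T \<zeta>) \<and> \<phi> (T \<zeta>, vec_exp (vec_of_real x)) < ereal (Re (poly p (\<zeta> - c)))" for \<zeta> x
    by (simp add: G_def T_def)
  have sub: "sphere c \<rho> \<subseteq> cball c \<rho>" by auto
  have TU: "T \<zeta> \<in> fst ` \<Omega>" if "\<zeta> \<in> cball c \<rho>" for \<zeta>
    using x0[OF that] unfolding log_fiber_def T_def by force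
  have convL: "convex (log_fiber \<Omega> (T \<zeta>))" if "\<zeta> \<in> cball c \<rho>" for \<zeta>
    by (rule convex_log_fiber[OF pc inv conn[OF TU[OF that]]])
  have "\<exists>X. continuous_on (sphere c \<rho>) X \<and> (\<forall>\<zeta>\<in>sphere c \<rho>. (\<zeta>, X \<zeta>) \<in> G)"
  proof (rule continuous_selection_convex[OF compact_sphere G])
    fix \<zeta> assume \<zeta>: "\<zeta> \<in> sphere c \<rho>"
    show "\<exists>x. (\<zeta>, x) \<in> G" using lt[OF \<zeta>] unfolding memG T_def by blast
    have "\<zeta> \<in> cball c \<rho>" using \<zeta> sub by blast
    then have "convex {x \<in> log_fiber \<Omega> (T \<zeta>). \<phi> (T \<zeta>, vec_exp (vec_of_real x)) < ereal (Re (poly p (\<zeta> - c)))}"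
      by (intro convex_log_sublevel[OF pc inv conn psh \<phi>inv] TU)
    then show "convex {x. (\<zeta>, x) \<in> G}" unfolding memG .
  qed
  then obtain X where Xc: "continuous_on (sphere c \<rho>) X" and XG: "\<And>\<zeta>. \<zeta> \<in> sphere c \<rho> \<Longrightarrow> (\<zeta>, X \<zeta>) \<in> G"
    by blast
  have "compact ((\<lambda>\<zeta>. (\<zeta>, X \<zeta>)) ` sphere c \<rho>)"
    by (intro compact_continuous_image continuous_on_Pair continuous_on_id Xc compact_sphere)
  moreover have "(\<lambda>\<zeta>. (\<zeta>, X \<zeta>)) ` sphere c \<rho> \<subseteq> G" using XG by blast
  ultimately obtain \<epsilon> where \<epsilon>: "0 < \<epsilon>" "(\<Union>q\<in>(\<lambda>\<zeta>. (\<zeta>, X \<zeta>)) ` sphere c \<rho>. cball q \<epsilon>) \<subseteq> G"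
    using compact_subset_open_imp_cball_epsilon_subset[OF _ G] by blast
  \<comment> \<open>The selection is replaced by the real part of a polynomial map, within \<open>\<epsilon>\<close> on the circle.\<close>
  define e where "e = \<epsilon> / real CARD('n)"
  have e: "0 < e" using \<epsilon> by (simp add: e_def)
  have "\<exists>P. \<forall>\<zeta>\<in>sphere c \<rho>. \<bar>X \<zeta> $ i - Re (poly P (\<zeta> - c))\<bar> < e" for i
    by (rule circle_approx_Re_poly[OF _ e]) (intro continuous_intros Xc)
  then obtain P where P: "\<And>i \<zeta>. \<zeta> \<in> sphere c \<rho> \<Longrightarrow> \<bar>X \<zeta> $ i - Re (poly (P i) (\<zeta> - c))\<bar> < e"
    by metis
  define Y where "Y \<zeta> = (\<chi> i. Re (poly (P i) (\<zeta> - c)))" for \<zeta>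
  have YG: "(\<zeta>, Y \<zeta>) \<in> G" if \<zeta>: "\<zeta> \<in> sphere c \<rho>" for \<zeta>
  proof -
    have "norm (X \<zeta> - Y \<zeta>) \<le> real CARD('n) * e"
      by (rule vec_norm_le_card) (use P[OF \<zeta>] in \<open>simp add: Y_def less_imp_le\<close>)
    also have "\<dots> = \<epsilon>" by (simp add: e_def)
    finally have "(\<zeta>, Y \<zeta>) \<in> cball (\<zeta>, X \<zeta>) \<epsilon>" by (simp add: dist_Pair_Pair dist_norm)
    then show ?thesis using \<epsilon>(2) \<zeta> by blast
  qed
  \<comment> \<open>\<open>F s\<close> deforms the disc with constant logarithm \<open>x0\<close> into the disc whose logarithm has the real part \<open>Y\<close>.\<close>
  define g where "g s i \<zeta> = of_real ((1 - s) * x0 $ i) + of_real s * poly (P i) (\<zeta> - c)" for s i and \<zeta> :: complex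
  define F where "F s \<zeta> = (a + \<zeta> *\<^sub>C b, vec_exp (\<chi> i. g s i \<zeta>))" for s \<zeta>
  have Reg: "vec_Re (\<chi> i. g s i \<zeta>) = (1 - s) *\<^sub>R x0 + s *\<^sub>R Y \<zeta>" for s \<zeta>
    by (simp add: vec_Re_def g_def Y_def vec_eq_iff)
  have F_in: "F s \<zeta> \<in> \<Omega> \<longleftrightarrow> (1 - s) *\<^sub>R x0 + s *\<^sub>R Y \<zeta> \<in> log_fiber \<Omega> (T \<zeta>)" for s \<zeta>
    unfolding F_def torus_invariant_vec_exp[OF inv] Reg T_def ..
  have jet: "\<exists>b d. has_jet2 (F s) z b d" for s z
    unfolding F_def g_def by (rule exp_disc_has_jet2) (intro holomorphic_intros)
  have fr: "frontier (cball c \<rho>) = sphere c \<rho>" by (rule frontier_cball)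
  have F1: "F 1 ` cball c \<rho> \<subseteq> \<Omega>"
  proof (rule disc_family_stays_inside[OF pc compact_cball, of c \<rho> F])
    show "continuous_on ({0..1} \<times> cball c \<rho>) (\<lambda>p. F (fst p) (snd p))"
      unfolding F_def g_def by (intro continuous_intros)
    show "\<exists>b d. has_jet2 (F s) z b d" if "s \<in> {0..1}" "z \<in> interior (cball c \<rho>)" for s z by (rule jet)
    show "F 0 ` cball c \<rho> \<subseteq> \<Omega>" using x0 by (auto simp: F_in T_def)
    show "F s ` frontier (cball c \<rho>) \<subseteq> \<Omega>" if s: "s \<in> {0..1}" for s
    proof
      fix q assume "q \<in> F s ` frontier (cball c \<rho>)"
      then obtain \<zeta> where \<zeta>: "\<zeta> \<in> sphere c \<rho>" "q = F s \<zeta>" unfolding fr by blast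
      then have \<zeta>c: "\<zeta> \<in> cball c \<rho>" using sub by blast
      have "(1 - s) *\<^sub>R x0 + s *\<^sub>R Y \<zeta> \<in> log_fiber \<Omega> (T \<zeta>)"
        by (rule convexD[OF convL[OF \<zeta>c]]) (use x0[OF \<zeta>c] YG[OF \<zeta>(1)] s in \<open>auto simp: memG T_def\<close>)
      then show "q \<in> \<Omega>" by (simp add: \<zeta>(2) F_in)
    qed
  qed simp
  have "\<phi> (F 1 c) \<le> ereal (Re (poly p (c - c)))"
  proof (rule disc_maximum_principle[OF psh, where f = "F 1" and q = "\<lambda>\<zeta>. poly p (\<zeta> - c)" and K = "cball c \<rho>"])
    show "continuous_on (cball c \<rho>) (F 1)"
      unfolding F_def g_def by (intro continuous_intros)
    show "\<exists>b d. has_jet2 (F 1) z b d" if "z \<in> interior (cball c \<rho>)" for z by (rule jet)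
    show "continuous_on (cball c \<rho>) (\<lambda>\<zeta>. poly p (\<zeta> - c))" by (intro continuous_intros)
    show "\<exists>b d. has_jet2 (\<lambda>\<zeta>. poly p (\<zeta> - c)) z b d" if "z \<in> interior (cball c \<rho>)" for z
      by (rule holomorphic_has_jet2[of _ UNIV]) (auto intro!: holomorphic_intros)
    show "F 1 ` cball c \<rho> \<subseteq> \<Omega>" by (rule F1)
    show "c \<in> cball c \<rho>" using \<rho> by simp
    show "compact (cball c \<rho>)" by simp
  next
    fix \<zeta> assume "\<zeta> \<in> frontier (cball c \<rho>)"
    then have \<zeta>: "\<zeta> \<in> sphere c \<rho>" by (simp only: fr)
    have Y: "vec_Re (\<chi> i. g 1 i \<zeta>) = Y \<zeta>" using Reg[of 1 \<zeta>] by simp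
    have "\<phi> (F 1 \<zeta>) = \<phi> (T \<zeta>, vec_exp (vec_of_real (Y \<zeta>)))"
      using torus_invariant_fun_vec_exp[OF inv \<phi>inv, of "\<chi> i. g 1 i \<zeta>" "T \<zeta>"] YG[OF \<zeta>]
      unfolding Y memG F_def T_def by blast
    then show "\<phi> (F 1 \<zeta>) \<le> ereal (Re (poly p (\<zeta> - c)))"
      using YG[OF \<zeta>] unfolding memG by (simp add: less_imp_le)
  qed
  moreover have "F 1 c \<in> \<Omega>" using F1 \<rho> by auto
  ultimately show ?thesis unfolding F_def fiber_def by auto
qed

section \<open>The marginal function\<close>

text \<open>
  The set where \<open>\<phi> < c\<close> is open, so vanishing coordinates may be replaced by small nonzero ones.
\<close>

lemma log_point_below:
  fixes \<Omega> :: "((complex ^ 'r::finite) \<times> (complex ^ 'n::finite)) set"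
  assumes psh: "plurisubharmonic_on \<Omega> \<phi>" and inv: "torus_invariant \<Omega>"
    and \<phi>inv: "torus_invariant_fun \<Omega> \<phi>"
    and tz: "(t, z) \<in> \<Omega>" "\<phi> (t, z) < c"
  shows "\<exists>x\<in>log_fiber \<Omega> t. \<phi> (t, vec_exp (vec_of_real x)) < c"
proof -
  have \<Omega>: "open \<Omega>" and usc: "upper_semicontinuous_on \<Omega> \<phi>"
    using psh unfolding plurisubharmonic_on_def by blast+
  have "open {p \<in> \<Omega>. \<phi> p < c}"
    using usc \<Omega> openin_open_eq unfolding upper_semicontinuous_on_def by blast
  then obtain e where e: "0 < e" "cball (t, z) e \<subseteq> {p \<in> \<Omega>. \<phi> p < c}"
    using tz open_contains_cball by (metis (mono_tags, lifting) mem_Collect_eq)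
  define \<eta> where "\<eta> = e / real CARD('n)"
  have \<eta>: "0 < \<eta>" using e by (simp add: \<eta>_def)
  define z' where "z' = (\<chi> i. if z $ i = 0 then of_real \<eta> else z $ i)"
  have "norm (z - z') \<le> real CARD('n) * \<eta>"
    by (rule vec_norm_le_card) (use \<eta> in \<open>simp add: z'_def\<close>)
  also have "\<dots> = e" by (simp add: \<eta>_def)
  finally have "(t, z') \<in> cball (t, z) e" by (simp add: dist_Pair_Pair dist_norm)
  then have z': "(t, z') \<in> \<Omega>" "\<phi> (t, z') < c" using e(2) by blast+
  define w where "w = (\<chi> i. Ln (z' $ i))"
  have "z' $ i \<noteq> 0" for i using \<eta> by (simp add: z'_def)
  then have w: "vec_exp w = z'" by (simp add: vec_exp_def w_def vec_eq_iff)
  have "vec_Re w \<in> log_fiber \<Omega> t" using z'(1) torus_invariant_vec_exp[OF inv, of t w] by (simp add: w)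
  then show ?thesis
    using torus_invariant_fun_vec_exp[OF inv \<phi>inv, of w t] z'(2) by (auto simp: w)
qed

text \<open>
  If the bound fails, add \<open>\<epsilon> * |\<zeta> - c|\<^sup>2\<close> with \<open>\<epsilon>\<close> so small that the difference of the two sides still has
  its maximum over the disc at an interior point \<open>\<zeta>0\<close>. Seen from \<open>\<zeta>0\<close>, the function \<open>|\<zeta> - c|\<^sup>2\<close> equals
  \<open>|\<zeta> - \<zeta>0|\<^sup>2\<close> plus the real part of an affine polynomial. So near \<open>\<zeta>0\<close> the function \<open>v\<close> lies below the real
  part of a polynomial \<open>p1\<close> minus \<open>\<epsilon> * |\<zeta> - \<zeta>0|\<^sup>2\<close>, with equality at \<open>\<zeta>0\<close>, which contradicts the
  minimum principle on a small disc around \<open>\<zeta>0\<close>.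
\<close>

lemma marginal_le_Re_poly:
  fixes \<Omega> :: "((complex ^ 'r::finite) \<times> (complex ^ 'n::finite)) set"
  assumes pc: "pseudoconvex \<Omega>" and inv: "torus_invariant \<Omega>"
    and conn: "\<And>t. t \<in> fst ` \<Omega> \<Longrightarrow> connected (fiber \<Omega> t)"
    and psh: "plurisubharmonic_on \<Omega> \<phi>" and \<phi>inv: "torus_invariant_fun \<Omega> \<phi>"
    and v: "v = (\<lambda>t. INF z \<in> fiber \<Omega> t. \<phi> (t, z))"
    and usc: "upper_semicontinuous_on (fst ` \<Omega>) v" and fin: "\<And>t. t \<in> fst ` \<Omega> \<Longrightarrow> v t < \<infinity>"
    and R: "0 < R" and disc: "\<And>\<zeta>. \<zeta> \<in> cball c R \<Longrightarrow> a + \<zeta> *\<^sub>C b \<in> fst ` \<Omega>"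
    and lt: "\<And>\<zeta>. \<zeta> \<in> sphere c R \<Longrightarrow> v (a + \<zeta> *\<^sub>C b) < ereal (Re (poly p (\<zeta> - c)))"
  shows "v (a + c *\<^sub>C b) \<le> ereal (Re (poly p 0))"
proof (rule ccontr)
  define T where "T \<zeta> = a + \<zeta> *\<^sub>C b" for \<zeta>
  have below: "\<exists>x\<in>log_fiber \<Omega> t. \<phi> (t, vec_exp (vec_of_real x)) < C"
    if vt: "v t < C" for t C
  proof -
    from vt obtain z where "z \<in> fiber \<Omega> t" "\<phi> (t, z) < C" unfolding v INF_less_iff by blast
    then show ?thesis using log_point_below[OF psh inv \<phi>inv, of t z C] by (simp add: fiber_def)
  qed
  assume "\<not> v (a + c *\<^sub>C b) \<le> ereal (Re (poly p 0))"
  then have "ereal (Re (poly p 0)) < v (T c)" by (simp add: T_def)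
  then obtain r' where r': "ereal (Re (poly p 0)) < ereal r'" "ereal r' < v (T c)"
    using ereal_dense2 by blast
  define r where "r = r' - Re (poly p 0)"
  have r: "0 < r" using r' by (simp add: r_def)
  define \<epsilon> where "\<epsilon> = r / R\<^sup>2"
  have \<epsilon>: "0 < \<epsilon>" using r R by (simp add: \<epsilon>_def)
  define k where "k \<zeta> = - Re (poly p (\<zeta> - c)) + \<epsilon> * (cmod (\<zeta> - c))\<^sup>2" for \<zeta>
  define m where "m \<zeta> = v (T \<zeta>) + ereal (k \<zeta>)" for \<zeta>
  have Tc: "continuous_on A T" for A unfolding T_def by (intro continuous_intros)
  have "upper_semicontinuous_on (cball c R) m"
    unfolding m_def
  proof (rule usc_add_continuous)
    show "upper_semicontinuous_on (cball c R) (\<lambda>\<zeta>. v (T \<zeta>))"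
      by (rule usc_compose[OF usc Tc]) (use disc in \<open>auto simp: T_def\<close>)
    show "continuous_on (cball c R) k" unfolding k_def by (intro continuous_intros)
  qed
  moreover have "cball c R \<noteq> {}" using R by simp
  ultimately obtain \<zeta>0 where \<zeta>0: "\<zeta>0 \<in> cball c R" and max: "\<And>\<zeta>. \<zeta> \<in> cball c R \<Longrightarrow> m \<zeta> \<le> m \<zeta>0"
    using usc_attains_sup[OF compact_cball] by metis
  have mc: "ereal r < m c"
    using r'(2) by (cases "v (T c)") (auto simp: m_def k_def r_def)
  then have m0: "ereal r < m \<zeta>0" using max[of c] R by (simp add: less_le_trans)
  have "\<zeta>0 \<notin> sphere c R"
  proof
    assume s: "\<zeta>0 \<in> sphere c R"
    then have "cmod (\<zeta>0 - c) = R" by (simp add: dist_norm norm_minus_commute)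
    then have "k \<zeta>0 = - Re (poly p (\<zeta>0 - c)) + r" using R by (simp add: k_def \<epsilon>_def)
    then have "m \<zeta>0 \<le> ereal r" using lt[OF s] by (cases "v (T \<zeta>0)") (auto simp: m_def T_def)
    then show False using m0 by simp
  qed
  then have \<zeta>0': "\<zeta>0 \<in> ball c R" using \<zeta>0 by simp
  have T0: "T \<zeta>0 \<in> fst ` \<Omega>" using disc[OF \<zeta>0] by (simp add: T_def)
  obtain V where V: "v (T \<zeta>0) = ereal V"
    using m0 fin[OF T0] by (cases "v (T \<zeta>0)") (auto simp: m_def)
  define p1 where "p1 = p \<circ>\<^sub>p [:\<zeta>0 - c, 1:] +
    [:of_real (V + k \<zeta>0 - \<epsilon> * (cmod (\<zeta>0 - c))\<^sup>2), - of_real (2 * \<epsilon>) * cnj (\<zeta>0 - c):]"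
  have p1: "V + k \<zeta>0 - k \<zeta> = Re (poly p1 (\<zeta> - \<zeta>0)) - \<epsilon> * (cmod (\<zeta> - \<zeta>0))\<^sup>2" for \<zeta>
  proof -
    define A where "A = \<zeta>0 - c"
    define W where "W = \<zeta> - \<zeta>0"
    have s: "\<zeta> - c = A + W" by (simp add: A_def W_def)
    have "(cmod (A + W))\<^sup>2 = (cmod A)\<^sup>2 + 2 * Re (cnj A * W) + (cmod W)\<^sup>2"
      by (simp only: cmod_power2) (simp add: power2_eq_square algebra_simps)
    then have "k \<zeta> = - Re (poly p (A + W)) + \<epsilon> * (cmod A)\<^sup>2 + 2 * \<epsilon> * Re (cnj A * W) + \<epsilon> * (cmod W)\<^sup>2"
      by (simp add: k_def s algebra_simps)
    moreover have "Re (poly p1 W) = Re (poly p (A + W)) + (V + k \<zeta>0 - \<epsilon> * (cmod A)\<^sup>2) - 2 * \<epsilon> * Re (cnj A * W)"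
    proof -
      have *: "Re (of_real s * x) = s * Re x" for s x by simp
      have "poly p1 W = poly p (A + W) + of_real (V + k \<zeta>0 - \<epsilon> * (cmod A)\<^sup>2) - of_real (2 * \<epsilon>) * (cnj A * W)"
        unfolding p1_def A_def[symmetric] by (simp add: poly_pcompose algebra_simps)
      then show ?thesis by (simp only: plus_complex.sel minus_complex.sel * Re_complex_of_real)
    qed
    ultimately show ?thesis unfolding W_def[symmetric] by simp
  qed
  have upper: "v (T \<zeta>) \<le> ereal (Re (poly p1 (\<zeta> - \<zeta>0)) - \<epsilon> * (cmod (\<zeta> - \<zeta>0))\<^sup>2)"
    if "\<zeta> \<in> cball c R" for \<zeta>
  proof -
    have "v (T \<zeta>) + ereal (k \<zeta>) \<le> ereal (V + k \<zeta>0)" using max[OF that] by (simp add: m_def V)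
    then have "v (T \<zeta>) \<le> ereal (V + k \<zeta>0 - k \<zeta>)" by (cases "v (T \<zeta>)") auto
    then show ?thesis unfolding p1 .
  qed
  have V1: "Re (poly p1 0) = V" using p1[of \<zeta>0] by simp
  have "v (T \<zeta>0) < \<infinity>" by (rule fin[OF T0])
  from below[OF this] obtain x0 where x0: "x0 \<in> log_fiber \<Omega> (T \<zeta>0)" by blast
  have \<Omega>: "open \<Omega>" using psh unfolding plurisubharmonic_on_def by blast
  have "open ((\<lambda>\<zeta>. (T \<zeta>, vec_exp (vec_of_real x0))) -` \<Omega>)"
    by (rule open_vimage[OF \<Omega>]) (intro continuous_on_Pair Tc continuous_on_const)
  then have "open ((\<lambda>\<zeta>. (T \<zeta>, vec_exp (vec_of_real x0))) -` \<Omega> \<inter> ball c R)" by (intro open_Int) auto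
  moreover have "\<zeta>0 \<in> (\<lambda>\<zeta>. (T \<zeta>, vec_exp (vec_of_real x0))) -` \<Omega> \<inter> ball c R"
    using x0 \<zeta>0' by (simp add: log_fiber_def)
  ultimately obtain \<rho> where \<rho>: "0 < \<rho>"
    "cball \<zeta>0 \<rho> \<subseteq> (\<lambda>\<zeta>. (T \<zeta>, vec_exp (vec_of_real x0))) -` \<Omega> \<inter> ball c R"
    using open_contains_cball by meson
  \<comment> \<open>Half of the gap \<open>\<epsilon> * \<rho>\<^sup>2\<close> on the circle of radius \<open>\<rho>\<close>: \<open>v < Re p2\<close> on that circle, but
    \<open>v > Re p2\<close> at its center.\<close>
  define p2 where "p2 = p1 - [:of_real (\<epsilon> * \<rho>\<^sup>2 / 2):]"
  have p2: "Re (poly p2 w) = Re (poly p1 w) - \<epsilon> * \<rho>\<^sup>2 / 2" for w by (simp add: p2_def)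
  have e\<rho>: "0 < \<epsilon> * \<rho>\<^sup>2" using \<epsilon> \<rho> by simp
  have "\<exists>z\<in>fiber \<Omega> (a + \<zeta>0 *\<^sub>C b). \<phi> (a + \<zeta>0 *\<^sub>C b, z) \<le> ereal (Re (poly p2 0))"
  proof (rule minimum_principle_small_disc[OF pc inv conn psh \<phi>inv \<rho>(1)])
    fix \<zeta> assume "\<zeta> \<in> cball \<zeta>0 \<rho>"
    then show "x0 \<in> log_fiber \<Omega> (a + \<zeta> *\<^sub>C b)" using \<rho>(2) unfolding log_fiber_def T_def by blast
  next
    fix \<zeta> assume s: "\<zeta> \<in> sphere \<zeta>0 \<rho>"
    then have "\<zeta> \<in> cball \<zeta>0 \<rho>" by simp
    then have "\<zeta> \<in> ball c R" using \<rho>(2) by blast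
    then have "\<zeta> \<in> cball c R" by simp
    from upper[OF this] have "v (T \<zeta>) \<le> ereal (Re (poly p1 (\<zeta> - \<zeta>0)) - \<epsilon> * \<rho>\<^sup>2)"
      using s by (simp add: dist_norm norm_minus_commute)
    also have "\<dots> < ereal (Re (poly p2 (\<zeta> - \<zeta>0)))" using e\<rho> by (simp add: p2)
    finally show "\<exists>x\<in>log_fiber \<Omega> (a + \<zeta> *\<^sub>C b). \<phi> (a + \<zeta> *\<^sub>C b, vec_exp (vec_of_real x)) < ereal (Re (poly p2 (\<zeta> - \<zeta>0)))"
      using below[of "T \<zeta>"] by (simp add: T_def)
  qed
  then obtain z where z: "z \<in> fiber \<Omega> (T \<zeta>0)" "\<phi> (T \<zeta>0, z) \<le> ereal (Re (poly p2 0))"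
    unfolding T_def by blast
  have "v (T \<zeta>0) \<le> \<phi> (T \<zeta>0, z)" unfolding v by (rule INF_lower[OF z(1)])
  also note z(2)
  finally show False using e\<rho> by (simp add: V p2 V1)
qed

theorem theorem1p2:
  fixes \<Omega> :: "((complex ^ 'r::finite) \<times> (complex ^ 'n::finite)) set"
    and U :: "(complex ^ 'r) set"
    and \<phi> :: "(complex ^ 'r) \<times> (complex ^ 'n) \<Rightarrow> ereal"
  assumes "is_domain \<Omega>"
    and "pseudoconvex \<Omega>"
    and "U = fst ` \<Omega>"
    and "\<And>t. t \<in> U \<Longrightarrow> reinhardt_domain (fiber \<Omega> t)"
    and "plurisubharmonic_on \<Omega> \<phi>"
    and "\<And>t z \<alpha>. (t, z) \<in> \<Omega> \<Longrightarrow> \<alpha> \<in> torus \<Longrightarrow> \<phi> (t, torus_act \<alpha> z) = \<phi> (t, z)"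
  shows "plurisubharmonic_on U (\<lambda>t. INF z \<in> fiber \<Omega> t. \<phi> (t, z))"
proof -
  define v where "v = (\<lambda>t. INF z \<in> fiber \<Omega> t. \<phi> (t, z))"
  have \<Omega>: "open \<Omega>" and fin: "\<And>p. p \<in> \<Omega> \<Longrightarrow> \<phi> p < \<infinity>" and usc: "upper_semicontinuous_on \<Omega> \<phi>"
    using assms(5) unfolding plurisubharmonic_on_def by blast+
  have U: "open U" unfolding assms(3) by (rule open_image_fst[OF \<Omega>])
  have conn: "connected (fiber \<Omega> t)" if "t \<in> fst ` \<Omega>" for t
    using assms(4) that unfolding assms(3) reinhardt_domain_def is_domain_def by blast
  have inv: "torus_invariant \<Omega>"
    unfolding torus_invariant_def
  proof (intro allI impI)
    fix t :: "complex ^ 'r" and z \<alpha> :: "complex ^ 'n"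
    assume tz: "(t, z) \<in> \<Omega>" and \<alpha>: "\<alpha> \<in> torus"
    then have "t \<in> U" unfolding assms(3) by force
    then have "torus_act \<alpha> ` fiber \<Omega> t = fiber \<Omega> t"
      using assms(4) \<alpha> unfolding reinhardt_domain_def by blast
    then show "(t, torus_act \<alpha> z) \<in> \<Omega>" using tz unfolding fiber_def by blast
  qed
  have \<phi>inv: "torus_invariant_fun \<Omega> \<phi>" using assms(6) unfolding torus_invariant_fun_def by blast
  have vlt: "{t \<in> U. v t < c} = fst ` {p \<in> \<Omega>. \<phi> p < c}" for c
    unfolding v_def INF_less_iff fiber_def assms(3) by force
  have vusc: "upper_semicontinuous_on U v"
    unfolding upper_semicontinuous_on_def
  proof
    fix c
    have "open {p \<in> \<Omega>. \<phi> p < c}"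
      using usc \<Omega> openin_open_eq unfolding upper_semicontinuous_on_def by blast
    then have "open {t \<in> U. v t < c}" unfolding vlt by (rule open_image_fst)
    then show "openin (top_of_set U) {t \<in> U. v t < c}" by (rule open_subset[rotated]) auto
  qed
  have vfin: "v t < \<infinity>" if t: "t \<in> U" for t
  proof -
    have "t \<in> {t \<in> U. v t < \<infinity>}" unfolding vlt using t fin unfolding assms(3) by auto
    then show ?thesis by blast
  qed
  have "subharmonic_on {\<zeta>. a + \<zeta> *\<^sub>C b \<in> U} (\<lambda>\<zeta>. v (a + \<zeta> *\<^sub>C b))" for a b :: "complex ^ 'r"
    unfolding subharmonic_on_def
  proof (intro conjI ballI allI impI)
    have Tc: "continuous_on A (\<lambda>\<zeta>. a + \<zeta> *\<^sub>C b)" for A by (intro continuous_intros)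
    show "open {\<zeta>. a + \<zeta> *\<^sub>C b \<in> U}"
      using open_vimage[OF U Tc] by (simp add: vimage_def)
    show "v (a + \<zeta> *\<^sub>C b) < \<infinity>" if "\<zeta> \<in> {\<zeta>. a + \<zeta> *\<^sub>C b \<in> U}" for \<zeta> using vfin that by simp
    show vTusc: "upper_semicontinuous_on {\<zeta>. a + \<zeta> *\<^sub>C b \<in> U} (\<lambda>\<zeta>. v (a + \<zeta> *\<^sub>C b))"
      by (rule usc_compose[OF vusc Tc]) auto
    fix c R assume cR: "0 < R \<and> cball c R \<subseteq> {\<zeta>. a + \<zeta> *\<^sub>C b \<in> U}"
    then have R: "0 < R" and disc: "\<And>\<zeta>. \<zeta> \<in> cball c R \<Longrightarrow> a + \<zeta> *\<^sub>C b \<in> U" by blast+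
    have sph: "sphere c R \<subseteq> {\<zeta>. a + \<zeta> *\<^sub>C b \<in> U}" using disc by auto
    show "v (a + c *\<^sub>C b) \<le> circle_mean (\<lambda>\<zeta>. v (a + \<zeta> *\<^sub>C b)) c R"
    proof (rule le_circle_mean[OF R usc_subset[OF vTusc sph]])
      show "v (a + z *\<^sub>C b) < \<infinity>" if "z \<in> sphere c R" for z using vfin sph that by blast
    next
      fix p assume lt: "\<And>z. z \<in> sphere c R \<Longrightarrow> v (a + z *\<^sub>C b) < ereal (Re (poly p (z - c)))"
      show "v (a + c *\<^sub>C b) \<le> ereal (Re (poly p 0))"
      proof (rule marginal_le_Re_poly[where \<Omega> = \<Omega> and \<phi> = \<phi> and v = v and R = R and c = c and a = a and b = b and p = p])
        show "pseudoconvex \<Omega>" by (rule assms(2))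
        show "upper_semicontinuous_on (fst ` \<Omega>) v" using vusc unfolding assms(3) .
        show "v t < \<infinity>" if "t \<in> fst ` \<Omega>" for t using vfin that unfolding assms(3) .
        show "a + \<zeta> *\<^sub>C b \<in> fst ` \<Omega>" if "\<zeta> \<in> cball c R" for \<zeta> using disc[OF that] unfolding assms(3) .
        show "v (a + \<zeta> *\<^sub>C b) < ereal (Re (poly p (\<zeta> - c)))" if "\<zeta> \<in> sphere c R" for \<zeta> by (rule lt[OF that])
      qed (rule inv conn assms(5) \<phi>inv v_def R; assumption)+
    qed
  qed
  then show ?thesis
    unfolding plurisubharmonic_on_def using U vfin vusc unfolding v_def by blast
qed

end
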